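(* Let $g:\mathbb{R}^d\to[0,\infty)$ be Lipschitz continuous, let $\alpha\in(0,1)$, and let $Q\in\mathcal{P}(\mathbb{R}^d)$ have finite first moment (hence $\mathbb{E}_Q[g]<\infty$). For $y\in\mathbb{R}$ define $h^y(x):=\frac{(g(x)-y)^+}{1-\alpha}$, and let $T(Q)=[\mathrm{VaR}_\alpha^{Q,g},\overline{\mathrm{VaR}}_\alpha^{Q,g}]$. For a perturbation $\rho$ write $Q^\epsilon:=Q+\epsilon\rho$. Then: 1. (Right derivative) For every right-admissible perturbation $\rho$ at $Q$, the right directional derivative exists and $$D^+_\rho \mathrm{CVaR}_\alpha^{Q,g}:=\lim_{\epsilon\to0^+}\frac{\mathrm{CVaR}_\alpha^{Q^\epsilon,g}-\mathrm{CVaR}_\alpha^{Q,g}}{\epsilon}=\min_{y\in T(Q)}\int h^y\,d\rho.$$ 2. (Left derivative) For every left-admissible perturbation $\rho$ at $Q$, the left directional derivative exists and $$D^-_\rho \mathrm{CVaR}_\alpha^{Q,g}:=\lim_{\epsilon\to0^-}\frac{\mathrm{CVaR}_\alpha^{Q^\epsilon,g}-\mathrm{CVaR}_\alpha^{Q,g}}{\epsilon}=\max_{y\in T(Q)}\int h^y\,d\rho.$$ 3. (Variational subgradients) Let $y\in T(Q)$. For any admissible $\rho$ at $Q$, $\int h^y\,d\rho$ lies in $[D^+_\rho\mathrm{CVaR}_\alpha^{Q,g},\,D^-_\rho\mathrm{CVaR}_\alpha^{Q,g}]$. Consequently, for each $y\in T(Q)$, $h^y$ is a variational subgradient of the functional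 $Q\mapsto\mathrm{CVaR}_\alpha^{Q,g}$ at $Q$. 4. (Two-sided derivative) For an admissible $\rho$ at $Q$, the two-sided (Gateaux) derivative $\lim_{\epsilon\to0}\frac{1}{\epsilon}(\mathrm{CVaR}_\alpha^{Q^\epsilon,g}-\mathrm{CVaR}_\alpha^{Q,g})$ exists if and only if $y\mapsto\int h^y\,d\rho$ is constant on $T(Q)$. This holds for every admissible $\rho$ at $Q$ if and only if $T(Q)$ is a singleton, i.e. $\mathrm{VaR}_\alpha^{Q,g}=\overline{\mathrm{VaR}}_\alpha^{Q,g}$, in which case $\mathrm{CVaR}_\alpha^{\cdot,g}$ is Gateaux differentiable at $Q$ with first variation $$\frac{\delta\,\mathrm{CVaR}_\alpha^{Q,g}}{\delta Q}=h^{\mathrm{VaR}_\alpha^{Q,g}}=\frac{(g-\mathrm{VaR}_\alpha^{Q,g})^+}{1-\alpha},$$ that is, the two-sided derivative in every admissible direction $\rho$ equals $\int h^{\mathrm{VaR}_\alpha^{Q,g}}\,d\rho$.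
   Context: $\mathcal{P}(\mathbb{R}^d)$ is the set of Borel probability measures on $\mathbb{R}^d$. $\mathcal{W}_1$ is the Wasserstein-1 metric. VaR and CVaR. For $Q$ with $\mathbb{E}_Q[g]<\infty$, let $\Psi^{Q,g}(c)=Q(g\le c)$ and $\mathrm{VaR}_\alpha^{Q,g}:=\inf\{c\in\mathbb{R}:\Psi^{Q,g}(c)\ge\alpha\}$, $\overline{\mathrm{VaR}}_\alpha^{Q,g}:=\inf\{c\in\mathbb{R}:\Psi^{Q,g}(c)>\alpha\}$. CVaR is $\mathrm{CVaR}_\alpha^{Q,g}:=\beta\,\mathrm{VaR}_\alpha^{Q,g}+(1-\beta)\,\mathbb{E}_Q[g(X)\mid g(X)>\mathrm{VaR}_\alpha^{Q,g}]$ with $\beta=\frac{\Psi^{Q,g}(\mathrm{VaR}_\alpha^{Q,g})-\alpha}{1-\alpha}$ (second term read as $0$ if $\beta=1$). Known equivalent form (Rockafellar–Uryasev): $\mathrm{CVaR}_\alpha^{Q,g}=\inf_{y\in\mathbb{R}}F_\alpha^{Q,g}(y)$, where $F_\alpha^{Q,g}(y)=y+\frac{1}{1-\alpha}\mathbb{E}_Q[(g-y)^+]$, and the set of minimizers is $T(Q)=[\mathrm{VaR}_\alpha^{Q,g},\overline{\mathrm{VaR}}_\alpha^{Q,g}]$. Admissible perturbations. A signed measure $\rho$ on $\mathbb{R}^d$ is right-admissible at $Q$ if $\int d\rho=0$, $\int d|\rho|<\infty$, $\int\|x\|\,d|\rho|<\infty$, and $Q+\epsilon\rho\in\mathcal{P}(\mathbb{R}^d)$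 for all sufficiently small $\epsilon>0$. It is left-admissible at $Q$ if $-\rho$ is right-admissible at $Q$, and admissible at $Q$ if it is both right- and left-admissible at $Q$. Variational subgradients. For a functional $J$ that is locally Lipschitz with respect to $\mathcal{W}_1$ near $Q$, and $\rho$ admissible at $Q$, the Clarke generalized directional derivative is $J^\circ(Q;\rho):=\limsup_{Q'\to Q,\ t\downarrow0}\frac{J(Q'+t\rho)-J(Q')}{t}$, where $Q'\to Q$ in $\mathcal{W}_1$ and only pairs $(Q',t)$ with $Q',\,Q'+t\rho\in\mathcal{P}(\mathbb{R}^d)$ are considered. A function $\xi$ is a (first) variational subgradient of $J$ at $Q$ if $J^\circ(Q;\rho)\ge\int\xi\,d\rho$ for all $\rho$ admissible at $Q$. (The term "subgradient" is used irrespective of convexity or concavity of $J$.) *)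

theory Defs
  imports "HOL-Probability.Probability"
begin

definition borel_probs :: "'a::topological_space measure set" where
  "borel_probs = {Q. prob_space Q \<and> sets Q = sets borel}"

text \<open>The Wasserstein distance is extended-valued here, so that it makes sense on all Borel
  probability measures; it is finite between measures with finite first moment.\<close>

definition couplings ::
    "'a::euclidean_space measure \<Rightarrow> 'a measure \<Rightarrow> ('a \<times> 'a) measure set" where
  "couplings P Q =
    {\<pi>. sets \<pi> = sets (borel \<Otimes>\<^sub>M borel) \<and> distr \<pi> borel fst = P \<and> distr \<pi> borel snd = Q}"

definition wasserstein1 :: "'a::euclidean_space measure \<Rightarrow> 'a measure \<Rightarrow> ennreal" where
  "wasserstein1 P Q = (INF \<pi>\<in>couplings P Q. \<integral>\<^sup>+z. ennreal (dist (fst z) (snd z)) \<partial>\<pi>)"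


text \<open>A (finite) signed Borel measure is a real-valued countably additive set function; its values
  outside the Borel sets are irrelevant. Infinite values are not needed, since only signed measures
  of finite total variation occur.\<close>

definition signed_measure :: "('a::topological_space set \<Rightarrow> real) \<Rightarrow> bool" where
  "signed_measure \<rho> \<longleftrightarrow> \<rho> {} = 0 \<and>
    (\<forall>A :: nat \<Rightarrow> 'a set. range A \<subseteq> sets borel \<longrightarrow> disjoint_family A \<longrightarrow>
      (\<lambda>i. \<rho> (A i)) sums \<rho> (\<Union>i. A i))"

text \<open>The Jordan decomposition: the positive part of \<open>\<rho>\<close> at \<open>A\<close> is the supremum of \<open>\<rho> B\<close> over Borel
  \<open>B \<subseteq> A\<close>. Truncation by \<^const>\<open>ennreal\<close> is harmless since \<open>B = {}\<close> contributes \<open>0\<close>.\<close>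

definition pos_part :: "('a::topological_space set \<Rightarrow> real) \<Rightarrow> 'a measure" where
  "pos_part \<rho> =
    measure_of UNIV (sets borel) (\<lambda>A. SUP B\<in>{B \<in> sets borel. B \<subseteq> A}. ennreal (\<rho> B))"

definition neg_part :: "('a::topological_space set \<Rightarrow> real) \<Rightarrow> 'a measure" where
  "neg_part \<rho> = pos_part (\<lambda>A. - \<rho> A)"

definition total_variation :: "('a::topological_space set \<Rightarrow> real) \<Rightarrow> 'a measure" where
  "total_variation \<rho> =
    measure_of UNIV (sets borel) (\<lambda>A. emeasure (pos_part \<rho>) A + emeasure (neg_part \<rho>) A)"

definition signed_integrable ::
    "('a::topological_space set \<Rightarrow> real) \<Rightarrow> ('a \<Rightarrow> real) \<Rightarrow> bool" where
  "signed_integrable \<rho> f \<longleftrightarrow> integrable (pos_part \<rho>) f \<and> integrable (neg_part \<rho>) f"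

definition signed_integral :: "('a::topological_space set \<Rightarrow> real) \<Rightarrow> ('a \<Rightarrow> real) \<Rightarrow> real" where
  "signed_integral \<rho> f = (\<integral>x. f x \<partial>pos_part \<rho>) - (\<integral>x. f x \<partial>neg_part \<rho>)"


text \<open>\<open>perturb Q \<epsilon> \<rho>\<close> is the measure \<open>Q + \<epsilon>\<rho>\<close>; it is meaningful only if \<open>perturb_prob Q \<epsilon> \<rho>\<close>, which
  says that the set function \<open>Q + \<epsilon>\<rho>\<close> is a Borel probability measure.\<close>

definition perturb ::
    "'a::topological_space measure \<Rightarrow> real \<Rightarrow> ('a set \<Rightarrow> real) \<Rightarrow> 'a measure" where
  "perturb Q \<epsilon> \<rho> = measure_of UNIV (sets borel) (\<lambda>A. ennreal (measure Q A + \<epsilon> * \<rho> A))"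

definition perturb_prob ::
    "'a::topological_space measure \<Rightarrow> real \<Rightarrow> ('a set \<Rightarrow> real) \<Rightarrow> bool" where
  "perturb_prob Q \<epsilon> \<rho> \<longleftrightarrow>
    (\<exists>P\<in>borel_probs. \<forall>A\<in>sets borel. measure P A = measure Q A + \<epsilon> * \<rho> A)"

definition right_admissible ::
    "'a::euclidean_space measure \<Rightarrow> ('a set \<Rightarrow> real) \<Rightarrow> bool" where
  "right_admissible Q \<rho> \<longleftrightarrow>
    signed_measure \<rho> \<and>
    \<rho> UNIV = 0 \<and>
    emeasure (total_variation \<rho>) UNIV < \<infinity> \<and>
    (\<integral>\<^sup>+x. ennreal (norm x) \<partial>total_variation \<rho>) < \<infinity> \<and>
    (\<forall>\<^sub>F \<epsilon> in at_right 0. perturb_prob Q \<epsilon> \<rho>)"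

definition left_admissible ::
    "'a::euclidean_space measure \<Rightarrow> ('a set \<Rightarrow> real) \<Rightarrow> bool" where
  "left_admissible Q \<rho> \<longleftrightarrow> right_admissible Q (\<lambda>A. - \<rho> A)"

definition admissible ::
    "'a::euclidean_space measure \<Rightarrow> ('a set \<Rightarrow> real) \<Rightarrow> bool" where
  "admissible Q \<rho> \<longleftrightarrow> right_admissible Q \<rho> \<and> left_admissible Q \<rho>"


definition diff_quot ::
    "('a::topological_space measure \<Rightarrow> real) \<Rightarrow> 'a measure \<Rightarrow> ('a set \<Rightarrow> real) \<Rightarrow> real \<Rightarrow> real" where
  "diff_quot J Q \<rho> \<epsilon> = (J (perturb Q \<epsilon> \<rho>) - J Q) / \<epsilon>"

text \<open>The next two are meaningful only when the respective limit exists.\<close>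

definition right_deriv ::
    "('a::topological_space measure \<Rightarrow> real) \<Rightarrow> 'a measure \<Rightarrow> ('a set \<Rightarrow> real) \<Rightarrow> real" where
  "right_deriv J Q \<rho> = Lim (at_right 0) (diff_quot J Q \<rho>)"

definition left_deriv ::
    "('a::topological_space measure \<Rightarrow> real) \<Rightarrow> 'a measure \<Rightarrow> ('a set \<Rightarrow> real) \<Rightarrow> real" where
  "left_deriv J Q \<rho> = Lim (at_left 0) (diff_quot J Q \<rho>)"

definition gateaux_deriv_exists ::
    "('a::topological_space measure \<Rightarrow> real) \<Rightarrow> 'a measure \<Rightarrow> ('a set \<Rightarrow> real) \<Rightarrow> bool" where
  "gateaux_deriv_exists J Q \<rho> \<longleftrightarrow> (\<exists>l. (diff_quot J Q \<rho> \<longlongrightarrow> l) (at 0))"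

definition has_first_variation ::
    "('a::euclidean_space measure \<Rightarrow> real) \<Rightarrow> 'a measure \<Rightarrow> ('a \<Rightarrow> real) \<Rightarrow> bool" where
  "has_first_variation J Q \<xi> \<longleftrightarrow>
    (\<forall>\<rho>. admissible Q \<rho> \<longrightarrow>
      signed_integrable \<rho> \<xi> \<and> (diff_quot J Q \<rho> \<longlongrightarrow> signed_integral \<rho> \<xi>) (at 0))"


definition locally_lipschitz_W1 ::
    "('a::euclidean_space measure \<Rightarrow> real) \<Rightarrow> 'a measure \<Rightarrow> bool" where
  "locally_lipschitz_W1 J Q \<longleftrightarrow>
    (\<exists>\<delta>>0. \<exists>L\<ge>0. \<forall>P\<in>borel_probs. \<forall>P'\<in>borel_probs.
      wasserstein1 P Q < ennreal \<delta> \<longrightarrow> wasserstein1 P' Q < ennreal \<delta> \<longrightarrow>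
      ennreal \<bar>J P - J P'\<bar> \<le> ennreal L * wasserstein1 P P')"

text \<open>The filter of pairs \<open>(Q', t)\<close> with \<open>Q' \<rightarrow> Q\<close> in Wasserstein distance and \<open>t \<down> 0\<close>, restricted to
  those with \<open>Q'\<close> and \<open>Q' + t\<rho>\<close> probability measures.\<close>

definition clarke_filter ::
    "'a::euclidean_space measure \<Rightarrow> ('a set \<Rightarrow> real) \<Rightarrow> ('a measure \<times> real) filter" where
  "clarke_filter Q \<rho> =
    (INF \<delta>\<in>{0<..}. principal {(Q', t). Q' \<in> borel_probs \<and> wasserstein1 Q' Q < ennreal \<delta> \<and>
       0 < t \<and> t < \<delta> \<and> perturb_prob Q' t \<rho>})"

definition clarke_deriv ::
    "('a::euclidean_space measure \<Rightarrow> real) \<Rightarrow> 'a measure \<Rightarrow> ('a set \<Rightarrow> real) \<Rightarrow> ereal" where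
  "clarke_deriv J Q \<rho> = Limsup (clarke_filter Q \<rho>) (\<lambda>(Q', t). ereal (diff_quot J Q' \<rho> t))"

definition variational_subgradient ::
    "('a::euclidean_space measure \<Rightarrow> real) \<Rightarrow> 'a measure \<Rightarrow> ('a \<Rightarrow> real) \<Rightarrow> bool" where
  "variational_subgradient J Q \<xi> \<longleftrightarrow>
    locally_lipschitz_W1 J Q \<and>
    (\<forall>\<rho>. admissible Q \<rho> \<longrightarrow>
      signed_integrable \<rho> \<xi> \<and> clarke_deriv J Q \<rho> \<ge> ereal (signed_integral \<rho> \<xi>))"


definition Psi :: "('a \<Rightarrow> real) \<Rightarrow> 'a measure \<Rightarrow> real \<Rightarrow> real" where
  "Psi g Q c = measure Q {x \<in> space Q. g x \<le> c}"

definition VaR :: "real \<Rightarrow> ('a \<Rightarrow> real) \<Rightarrow> 'a measure \<Rightarrow> real" where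
  "VaR \<alpha> g Q = Inf {c. Psi g Q c \<ge> \<alpha>}"

definition VaR_upper :: "real \<Rightarrow> ('a \<Rightarrow> real) \<Rightarrow> 'a measure \<Rightarrow> real" where
  "VaR_upper \<alpha> g Q = Inf {c. Psi g Q c > \<alpha>}"

definition VaR_interval :: "real \<Rightarrow> ('a \<Rightarrow> real) \<Rightarrow> 'a measure \<Rightarrow> real set" where
  "VaR_interval \<alpha> g Q = {VaR \<alpha> g Q .. VaR_upper \<alpha> g Q}"

definition cond_expectation_event :: "'a measure \<Rightarrow> ('a \<Rightarrow> real) \<Rightarrow> 'a set \<Rightarrow> real" where
  "cond_expectation_event Q f A = (LINT x:A|Q. f x) / measure Q A"

text \<open>If \<open>\<beta> = 1\<close>, the event conditioned on is null, and the second summand vanishes.\<close>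

definition CVaR :: "real \<Rightarrow> ('a \<Rightarrow> real) \<Rightarrow> 'a measure \<Rightarrow> real" where
  "CVaR \<alpha> g Q =
    (let v = VaR \<alpha> g Q; \<beta> = (Psi g Q v - \<alpha>) / (1 - \<alpha>)
     in \<beta> * v + (1 - \<beta>) * cond_expectation_event Q g {x \<in> space Q. g x > v})"

definition excess :: "real \<Rightarrow> ('a \<Rightarrow> real) \<Rightarrow> real \<Rightarrow> 'a \<Rightarrow> real" where
  "excess \<alpha> g y x = max (g x - y) 0 / (1 - \<alpha>)"


definition is_minimum :: "real \<Rightarrow> real set \<Rightarrow> bool" where
  "is_minimum m S \<longleftrightarrow> m \<in> S \<and> (\<forall>s\<in>S. m \<le> s)"

definition is_maximum :: "real \<Rightarrow> real set \<Rightarrow> bool" where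
  "is_maximum m S \<longleftrightarrow> m \<in> S \<and> (\<forall>s\<in>S. s \<le> m)"

end

theory Submission imports Defs begin

text \<open>
  By Rockafellar and Uryasev, CVaR is the minimum over \<open>y\<close> of the convex function
  \<open>F(y) = y + E_Q[(g - y)\<^sup>+] / (1 - \<alpha>)\<close>, attained on \<open>T(Q)\<close>, and \<open>F\<close> is affine in \<open>Q\<close>. The right derivative
  is therefore an instance of Danskin's theorem, where convergence of the minimisers of the perturbed
  problems follows from convergence of the distribution functions. Replacing \<open>\<rho>\<close> by \<open>-\<rho>\<close> gives the left
  derivative, which bounds the Clarke derivative from below along \<open>Q' = Q - t\<rho>\<close>.

  The admissible directions are exactly the positive multiples \<open>\<rho> = k(P - Q)\<close> with \<open>P\<close> a probability
  measure of finite first moment. This reduces signed measures to pairs of probability measures and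
  makes \<open>Q + \<epsilon>\<rho>\<close> a mixture of \<open>P\<close> and \<open>Q\<close>, whose Wasserstein distance to \<open>Q\<close> is of order \<open>\<epsilon>\<close>.
\<close>

subsection \<open>The Rockafellar--Uryasev representation\<close>

text \<open>As an infimum over y of functionals affine in the measure, CVaR is concave in the
  measure. Hence the subgradient inequality cannot come from difference quotients based at Q: in the
  direction \<rho> their limit is the minimum over T(Q), which lies below the integral of h^y. The
  Clarke derivative helps because it also moves the base point and so sees the left derivative, the
  maximum.

  The minimisers of the perturbed problems need not converge to one point; only their distance to
  T(Q) tends to 0. This suffices because the integral of h^y against \<rho> is Lipschitz in y.

  The measures kP and kQ with \<rho> = kP - kQ may overlap, whereas integrals against \<rho> are
  defined by its Jordan parts. The identity pos + kQ = neg + kP bridges the two. It is kept in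
  additive form because subtraction in \<open>ennreal\<close> is truncated.\<close>

definition RU :: "real \<Rightarrow> ('a \<Rightarrow> real) \<Rightarrow> 'a measure \<Rightarrow> real \<Rightarrow> real" where
  "RU \<alpha> g Q y = y + (LINT x|Q. excess \<alpha> g y x)"

text \<open>The quantile theory is set up for one measure at a time, so that later proofs can
  interpret it at Q and at a perturbed measure side by side.\<close>

locale cvar_problem = prob_space Q for Q :: "'a measure" +
  fixes g :: "'a \<Rightarrow> real" and \<alpha> :: real
  assumes integrable_g: "integrable Q g"
    and alpha: "0 < \<alpha>" "\<alpha> < 1"
begin

lemma g_measurable [measurable]: "g \<in> borel_measurable Q"
  using integrable_g by auto

lemma integrable_excess: "integrable Q (excess \<alpha> g y)"
  unfolding excess_def using integrable_g by auto

section \<open>Quantiles and the distribution function of g\<close>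

lemma Psi_eq_cdf: "Psi g Q = cdf (distr Q borel g)"
  by (auto simp: Psi_def cdf_def measure_distr vimage_def Int_def conj_commute)

lemma real_distribution_g: "real_distribution (distr Q borel g)"
  by simp

lemma Psi_mono: "x \<le> y \<Longrightarrow> Psi g Q x \<le> Psi g Q y"
proof -
  interpret D: real_distribution "distr Q borel g" by (rule real_distribution_g)
  show "x \<le> y \<Longrightarrow> Psi g Q x \<le> Psi g Q y"
    unfolding Psi_eq_cdf by (rule D.cdf_nondecreasing)
qed

lemma Psi_at_right: "(Psi g Q \<longlongrightarrow> Psi g Q c) (at_right c)"
proof -
  interpret D: real_distribution "distr Q borel g" by (rule real_distribution_g)
  show ?thesis
    unfolding Psi_eq_cdf using D.cdf_is_right_cont[of c] by (simp add: continuous_within)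
qed

lemma Psi_small: obtains b where "Psi g Q b < \<alpha>"
proof -
  interpret D: real_distribution "distr Q borel g" by (rule real_distribution_g)
  have "\<forall>\<^sub>F c in at_bot. Psi g Q c < \<alpha>"
    unfolding Psi_eq_cdf using order_tendstoD(2)[OF D.cdf_lim_at_bot] alpha by auto
  then show ?thesis using that by (auto simp: eventually_at_bot_linorder)
qed

lemma Psi_large: obtains b where "\<alpha> < Psi g Q b"
proof -
  interpret D: real_distribution "distr Q borel g" by (rule real_distribution_g)
  have "\<forall>\<^sub>F c in at_top. \<alpha> < Psi g Q c"
    unfolding Psi_eq_cdf using order_tendstoD(1)[OF D.cdf_lim_at_top_prob] alpha by auto
  then show ?thesis using that by (auto simp: eventually_at_top_linorder)
qed

lemma bdd_below_Psi_ge: "bdd_below {c. \<alpha> \<le> Psi g Q c}"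
proof -
  obtain b where "Psi g Q b < \<alpha>" by (rule Psi_small)
  then show ?thesis
    by (intro bdd_belowI[of _ b]) (metis Psi_mono mem_Collect_eq leD le_cases order_trans)
qed

lemma bdd_below_Psi_gt: "bdd_below {c. \<alpha> < Psi g Q c}"
  by (rule bdd_below_mono[OF bdd_below_Psi_ge]) auto

lemma VaR_le: "\<alpha> \<le> Psi g Q c \<Longrightarrow> VaR \<alpha> g Q \<le> c"
  unfolding VaR_def by (rule cInf_lower[OF _ bdd_below_Psi_ge]) auto

lemma VaR_upper_le: "\<alpha> < Psi g Q c \<Longrightarrow> VaR_upper \<alpha> g Q \<le> c"
  unfolding VaR_upper_def by (rule cInf_lower[OF _ bdd_below_Psi_gt]) auto

lemma Psi_gt:
  assumes "VaR_upper \<alpha> g Q < c" shows "\<alpha> < Psi g Q c"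
proof -
  obtain d where "\<alpha> < Psi g Q d" by (rule Psi_large)
  with cInf_lessD[OF _ assms[unfolded VaR_upper_def]] obtain z where "\<alpha> < Psi g Q z" "z < c"
    by auto
  with Psi_mono[of z c] show ?thesis by simp
qed

lemma VaR_le_VaR_upper: "VaR \<alpha> g Q \<le> VaR_upper \<alpha> g Q"
proof (rule field_le_epsilon)
  fix e :: real assume "0 < e"
  then show "VaR \<alpha> g Q \<le> VaR_upper \<alpha> g Q + e"
    by (intro VaR_le less_imp_le Psi_gt) simp
qed

lemma VaR_ge: "Psi g Q c < \<alpha> \<Longrightarrow> c \<le> VaR \<alpha> g Q"
proof (rule ccontr)
  assume c: "Psi g Q c < \<alpha>" "\<not> c \<le> VaR \<alpha> g Q"
  obtain d where "\<alpha> < Psi g Q d" by (rule Psi_large)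
  with cInf_lessD[of "{c. \<alpha> \<le> Psi g Q c}" c] c obtain z where "\<alpha> \<le> Psi g Q z" "z < c"
    by (fastforce simp: VaR_def not_le intro: less_imp_le)
  with Psi_mono[of z c] c show False by simp
qed

text \<open>Every point to the right of the quantile has level at least \<alpha>, and right
  continuity of the distribution function passes this to the quantile itself: the infimum is
  attained.\<close>

lemma Psi_VaR_ge: "\<alpha> \<le> Psi g Q (VaR \<alpha> g Q)"
proof (rule tendsto_lowerbound[OF Psi_at_right])
  show "\<forall>\<^sub>F c in at_right (VaR \<alpha> g Q). \<alpha> \<le> Psi g Q c"
    using VaR_ge by (auto simp: eventually_at_filter not_le intro!: always_eventually)
      (meson leD not_le)
qed simp

lemma integral_indicator_gt:
  "(LINT x|Q. (of_bool (z < g x) :: real)) = 1 - Psi g Q z"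
proof -
  have "(LINT x|Q. (of_bool (z < g x) :: real)) = (LINT x|Q. indicator {x\<in>space Q. z < g x} x)"
    by (intro Bochner_Integration.integral_cong) auto
  also have "\<dots> = prob {x\<in>space Q. z < g x}" by simp
  also have "\<dots> = 1 - Psi g Q z"
    unfolding Psi_def by (subst prob_compl[symmetric]) (auto intro!: arg_cong[where f=prob])
  finally show ?thesis .
qed

lemma integrable_indicator_gt: "integrable Q (\<lambda>x. (of_bool (z < g x) :: real))"
  by (intro integrable_const_bound[of _ 1]) auto

section \<open>Convexity of the Rockafellar-Uryasev function and its minimisers\<close>

text \<open>A point where g exceeds z contributes slope -1 / (1 - \<alpha>) to the excess.
  Integrating these pointwise supporting lines gives \<open>RU\<close> the slope 1 - (1 - Psi z) /
  (1 - \<alpha>) = (Psi z - \<alpha>) / (1 - \<alpha>) at z, so locating minimisers reduces to the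
  sign of Psi - \<alpha>.\<close>

lemma RU_subgradient:
  "RU \<alpha> g Q z + (y - z) * (Psi g Q z - \<alpha>) / (1 - \<alpha>) \<le> RU \<alpha> g Q y"
proof -
  have "(LINT x|Q. excess \<alpha> g z x - (y - z) / (1 - \<alpha>) * of_bool (z < g x)) \<le> (LINT x|Q. excess \<alpha> g y x)"
  proof (intro integral_mono integrable_excess Bochner_Integration.integrable_diff integrable_mult_right integrable_indicator_gt)
    fix x show "excess \<alpha> g z x - (y - z) / (1 - \<alpha>) * of_bool (z < g x) \<le> excess \<alpha> g y x"
      using alpha unfolding excess_def
      by (auto simp: max_def divide_simps split: if_splits)
  qed
  then have "(LINT x|Q. excess \<alpha> g z x) - (y - z) / (1 - \<alpha>) * (1 - Psi g Q z) \<le> (LINT x|Q. excess \<alpha> g y x)"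
    by (subst (asm) Bochner_Integration.integral_diff)
      (simp_all add: integrable_excess integrable_indicator_gt integral_indicator_gt)
  then show ?thesis
    using alpha unfolding RU_def by (simp add: divide_simps) (simp add: algebra_simps)
qed

lemma excess_lipschitz: "\<bar>excess \<alpha> g y x - excess \<alpha> g z x\<bar> \<le> \<bar>y - z\<bar> / (1 - \<alpha>)"
  using alpha unfolding excess_def diff_divide_distrib[symmetric] abs_divide
  by (auto intro!: divide_right_mono)

lemma integral_excess_lipschitz:
  "\<bar>(LINT x|Q. excess \<alpha> g y x) - (LINT x|Q. excess \<alpha> g z x)\<bar> \<le> \<bar>y - z\<bar> / (1 - \<alpha>)"
proof -
  have "\<bar>(LINT x|Q. excess \<alpha> g y x) - (LINT x|Q. excess \<alpha> g z x)\<bar>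
      = \<bar>LINT x|Q. excess \<alpha> g y x - excess \<alpha> g z x\<bar>"
    by (simp add: integrable_excess)
  also have "\<dots> \<le> (LINT x|Q. \<bar>excess \<alpha> g y x - excess \<alpha> g z x\<bar>)"
    by (rule integral_abs_bound)
  also have "\<dots> \<le> (LINT x|Q. \<bar>y - z\<bar> / (1 - \<alpha>))"
    by (intro integral_mono integrable_abs Bochner_Integration.integrable_diff integrable_excess
        excess_lipschitz) auto
  finally show ?thesis by (simp add: prob_space)
qed

lemma continuous_RU: "isCont (RU \<alpha> g Q) y"
proof -
  have "((\<lambda>z. (LINT x|Q. excess \<alpha> g z x)) \<longlongrightarrow> (LINT x|Q. excess \<alpha> g y x)) (at y)"
  proof (rule LIM_zero_cancel, rule tendsto_rabs_zero_cancel, rule tendsto_sandwich[of "\<lambda>_. 0"])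
    show "((\<lambda>z. \<bar>z - y\<bar> / (1 - \<alpha>)) \<longlongrightarrow> 0) (at y)"
      using alpha by (auto intro!: tendsto_eq_intros)
  qed (auto intro!: always_eventually integral_excess_lipschitz)
  then show ?thesis unfolding isCont_def RU_def[abs_def] by (auto intro!: tendsto_intros)
qed

lemma RU_VaR_le: "RU \<alpha> g Q (VaR \<alpha> g Q) \<le> RU \<alpha> g Q y"
proof (cases "VaR \<alpha> g Q \<le> y")
  case True
  have "0 \<le> (y - VaR \<alpha> g Q) * (Psi g Q (VaR \<alpha> g Q) - \<alpha>) / (1 - \<alpha>)"
    using True Psi_VaR_ge alpha by simp
  with RU_subgradient[of "VaR \<alpha> g Q" y] show ?thesis by linarith
next
  case False
  \<comment> \<open>The supporting line at the quantile is of no help on its left, since its slope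
    is nonnegative. Lines at points z strictly before the quantile have slope at most 0; continuity
    then carries the bound to the quantile.\<close>
  have le: "RU \<alpha> g Q z \<le> RU \<alpha> g Q y" if z: "y < z" "z < VaR \<alpha> g Q" for z
  proof -
    have "Psi g Q z \<le> \<alpha>" using VaR_le[of z] z by force
    then have "0 \<le> (y - z) * (Psi g Q z - \<alpha>) / (1 - \<alpha>)"
      using z alpha by (intro divide_nonneg_nonneg mult_nonpos_nonpos) auto
    with RU_subgradient[of z y] show ?thesis by linarith
  qed
  have "(RU \<alpha> g Q \<longlongrightarrow> RU \<alpha> g Q (VaR \<alpha> g Q)) (at_left (VaR \<alpha> g Q))"
    using continuous_RU[of "VaR \<alpha> g Q"] unfolding isCont_def filterlim_at_split by simp
  then show ?thesis
  proof (rule tendsto_upperbound)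
    show "\<forall>\<^sub>F z in at_left (VaR \<alpha> g Q). RU \<alpha> g Q z \<le> RU \<alpha> g Q y"
      using False le by (auto simp: eventually_at_left[of y] not_le intro!: exI[of _ y])
  qed simp
qed

lemma RU_VaR_interval:
  assumes "y \<in> VaR_interval \<alpha> g Q" shows "RU \<alpha> g Q y = RU \<alpha> g Q (VaR \<alpha> g Q)"
proof (rule antisym)
  let ?v = "VaR \<alpha> g Q"
  have y: "?v \<le> y" "y \<le> VaR_upper \<alpha> g Q" using assms by (auto simp: VaR_interval_def)
  \<comment> \<open>At \<open>VaR_upper\<close> the distribution function may already have jumped
    above \<alpha>. The bound is therefore shown on the half-open interval and reaches the endpoint
    as a left limit.\<close>
  have le: "RU \<alpha> g Q z \<le> RU \<alpha> g Q ?v" if z: "?v \<le> z" "z < VaR_upper \<alpha> g Q" for z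
  proof -
    have "Psi g Q z \<le> \<alpha>" using VaR_upper_le[of z] z by force
    then have "0 \<le> (?v - z) * (Psi g Q z - \<alpha>) / (1 - \<alpha>)"
      using z alpha by (intro divide_nonneg_nonneg mult_nonpos_nonpos) auto
    with RU_subgradient[of z ?v] show ?thesis by linarith
  qed
  show "RU \<alpha> g Q y \<le> RU \<alpha> g Q ?v"
  proof (cases "y = ?v")
    case False
    have "(RU \<alpha> g Q \<longlongrightarrow> RU \<alpha> g Q y) (at_left y)"
      using continuous_RU[of y] unfolding isCont_def filterlim_at_split by simp
    then show ?thesis
    proof (rule tendsto_upperbound)
      show "\<forall>\<^sub>F z in at_left y. RU \<alpha> g Q z \<le> RU \<alpha> g Q ?v"
        using False le y by (auto simp: eventually_at_left[of ?v] intro!: exI[of _ ?v])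
    qed simp
  qed simp
qed (rule RU_VaR_le)

text \<open>With p = Q(g > v) one has 1 - \<beta> = p / (1 - \<alpha>), so this weight cancels the
  denominator of the conditional mean I / p, and both sides become v + (I - v p) / (1 -
  \<alpha>).\<close>

theorem CVaR_eq_RU: "CVaR \<alpha> g Q = RU \<alpha> g Q (VaR \<alpha> g Q)"
proof -
  define v where "v = VaR \<alpha> g Q"
  define p where "p = 1 - Psi g Q v"
  define I where "I = (LINT x:{x \<in> space Q. v < g x}|Q. g x)"
  have p: "prob {x \<in> space Q. v < g x} = p"
    unfolding Psi_def p_def by (subst prob_compl[symmetric]) (auto intro!: arg_cong[where f=prob])
  have "(LINT x|Q. excess \<alpha> g v x)
      = (LINT x|Q. (indicator {x \<in> space Q. v < g x} x * g x - v * of_bool (v < g x)) / (1 - \<alpha>))"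
    by (intro Bochner_Integration.integral_cong)
      (auto simp: excess_def indicator_def max_def)
  also have "\<dots> = (I - v * p) / (1 - \<alpha>)"
    unfolding I_def set_lebesgue_integral_def p_def
    by (subst integral_divide_zero, subst Bochner_Integration.integral_diff)
      (auto simp: integrable_indicator_gt integral_indicator_gt intro!: integrable_mult_indicator[where 'b=real, simplified] integrable_g)
  finally have RU: "RU \<alpha> g Q v = v + (I - v * p) / (1 - \<alpha>)" by (simp add: RU_def)
  \<comment> \<open>If p = 0, the conditional mean is I / 0 = 0 in HOL. The cancellation p * (I / p)
    = I then rests on I = 0, which holds because the event is null.\<close>
  have I0: "I = 0" if "p = 0"
  proof -
    have "AE x in Q. x \<notin> {x \<in> space Q. v < g x}"
      using that p by (subst AE_iff_measurable[OF _ refl]) (auto simp: emeasure_eq_measure)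
    then have "I = (LINT x|Q. 0)"
      unfolding I_def set_lebesgue_integral_def by (intro integral_cong_AE) (auto simp: indicator_def)
    then show ?thesis by simp
  qed
  have "CVaR \<alpha> g Q = (1 - p - \<alpha>) / (1 - \<alpha>) * v + (1 - (1 - p - \<alpha>) / (1 - \<alpha>)) * (I / p)"
    unfolding CVaR_def Let_def cond_expectation_event_def I_def p_def p[unfolded p_def] v_def
    by (simp add: p[unfolded p_def v_def])
  also have "\<dots> = v + (I - v * p) / (1 - \<alpha>)"
  proof -
    have "1 - (1 - p - \<alpha>) / (1 - \<alpha>) = p / (1 - \<alpha>)" using alpha by (simp add: field_simps)
    then have "(1 - (1 - p - \<alpha>) / (1 - \<alpha>)) * (I / p) = p * (I / p) / (1 - \<alpha>)"
      by (simp only: times_divide_eq_left)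
    also have "p * (I / p) = I" using I0 by auto
    finally have "(1 - (1 - p - \<alpha>) / (1 - \<alpha>)) * (I / p) = I / (1 - \<alpha>)" .
    moreover have "(1 - p - \<alpha>) / (1 - \<alpha>) * v = v - v * p / (1 - \<alpha>)" using alpha by (simp add: field_simps)
    ultimately show ?thesis by (simp only: diff_divide_distrib)
  qed
  finally show ?thesis using RU by (simp add: v_def)
qed

lemma CVaR_le_RU: "CVaR \<alpha> g Q \<le> RU \<alpha> g Q y"
  using RU_VaR_le CVaR_eq_RU by simp

end

subsection \<open>Jordan decomposition of differences of measures\<close>

text \<open>For finite measures this transfers the identity M - N = N' - M' of signed measures from
  sets to integrals. All four integrals go through one induction; in the limit step, suprema of
  increasing sequences commute with addition.\<close>

lemma nn_integral_add_measure_cong: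
  assumes sets: "sets M' = sets M" "sets N = sets M" "sets N' = sets M"
    and eq: "\<And>A. A \<in> sets M \<Longrightarrow> emeasure M A + emeasure M' A = emeasure N A + emeasure N' A"
    and f: "f \<in> borel_measurable M"
  shows "(\<integral>\<^sup>+x. f x \<partial>M) + (\<integral>\<^sup>+x. f x \<partial>M') = (\<integral>\<^sup>+x. f x \<partial>N) + (\<integral>\<^sup>+x. f x \<partial>N')"
proof -
  note [measurable_cong] = sets
  note space = sets[THEN sets_eq_imp_space_eq]
  show ?thesis
    using f
  proof induction
    case (cong f g)
    have "(\<integral>\<^sup>+x. g x \<partial>K) = (\<integral>\<^sup>+x. f x \<partial>K)" if "space K = space M" for K
      using cong that by (intro nn_integral_cong) auto
    with cong space show ?case by simp
  next
    case (set A)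
    then show ?case using eq sets by simp
  next
    case (mult f c)
    then show ?case
      by (simp add: nn_integral_cmult distrib_left[symmetric])
  next
    case (add f g)
    have "(\<integral>\<^sup>+x. g x + f x \<partial>K) = (\<integral>\<^sup>+x. g x \<partial>K) + (\<integral>\<^sup>+x. f x \<partial>K)" if [measurable_cong]: "sets K = sets M" for K
      using add by (intro nn_integral_add) auto
    with add sets show ?case by (simp add: ac_simps)
  next
    case (seq U)
    have *: "nn_integral K (SUP i. U i) = (SUP i. nn_integral K (U i))" if [measurable_cong]: "sets K = sets M" for K
      unfolding SUP_apply[abs_def] using seq by (intro nn_integral_monotone_convergence_SUP) auto
    have inc: "incseq (\<lambda>i. nn_integral K (U i))" for K
      using seq by (auto intro!: nn_integral_mono simp: incseq_def le_fun_def)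
    show ?case
      using seq
      by (simp only: *[OF refl] *[OF sets(1)] *[OF sets(2)] *[OF sets(3)] ennreal_SUP_add[OF inc inc, symmetric])
  qed
qed

lemma signed_measure_Un:
  assumes \<rho>: "signed_measure \<rho>" and AB: "A \<in> sets borel" "B \<in> sets borel" "A \<inter> B = {}"
  shows "\<rho> (A \<union> B) = \<rho> A + \<rho> B"
proof -
  have "disjoint_family (binaryset A B)"
    using AB by (auto simp: disjoint_family_on_def binaryset_def)
  then have "(\<lambda>i. \<rho> (binaryset A B i)) sums \<rho> (A \<union> B)"
    using \<rho> AB unfolding signed_measure_def by (metis UN_binaryset_eq range_binaryset_eq empty_subsetI
      insert_subset sets.empty_sets)
  moreover have "(\<lambda>i. \<rho> (binaryset A B i)) sums (\<rho> A + \<rho> B)"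
    using \<rho> by (intro binaryset_sums) (auto simp: signed_measure_def)
  ultimately show ?thesis by (rule sums_unique2)
qed

lemma signed_measure_uminus: "signed_measure \<rho> \<Longrightarrow> signed_measure (\<lambda>A. - \<rho> A)"
  by (auto simp: signed_measure_def intro!: sums_minus)

lemma sets_pos_part [simp, measurable_cong]: "sets (pos_part \<rho>) = sets borel"
  unfolding pos_part_def by (simp add: sets.sigma_sets_eq[of borel, simplified])

lemma sets_neg_part [simp, measurable_cong]: "sets (neg_part \<rho>) = sets borel"
  by (simp add: neg_part_def)

lemma sets_total_variation [simp, measurable_cong]: "sets (total_variation \<rho>) = sets borel"
  unfolding total_variation_def by (simp add: sets.sigma_sets_eq[of borel, simplified])

text \<open>A Hahn set H turns the supremum defining \<open>pos_part\<close> into a maximum at A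
  \<inter> H: dropping from B what lies outside H and adding the rest of A \<inter> H can only
  increase \<rho>. The closed form makes countable additivity provable, without which
  \<open>measure_of\<close> would return the zero measure.\<close>

lemma emeasure_pos_part:
  assumes \<rho>: "signed_measure \<rho>" and H [measurable]: "H \<in> sets borel"
    and pos: "\<And>X. X \<in> sets borel \<Longrightarrow> X \<subseteq> H \<Longrightarrow> 0 \<le> \<rho> X"
    and neg: "\<And>X. X \<in> sets borel \<Longrightarrow> X \<inter> H = {} \<Longrightarrow> \<rho> X \<le> 0"
    and A: "A \<in> sets borel"
  shows "emeasure (pos_part \<rho>) A = ennreal (\<rho> (A \<inter> H))"
proof -
  have mono: "\<rho> B \<le> \<rho> (A \<inter> H)" if [measurable]: "A \<in> sets borel" "B \<in> sets borel" and "B \<subseteq> A" for A B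
  proof -
    have "\<rho> B = \<rho> (B \<inter> H) + \<rho> (B - H)"
      using signed_measure_Un[OF \<rho>, of "B \<inter> H" "B - H"] by (simp add: Int_Diff_Un Int_Diff_disjoint)
    moreover have "\<rho> (A \<inter> H) = \<rho> (B \<inter> H) + \<rho> ((A - B) \<inter> H)"
      using signed_measure_Un[OF \<rho>, of "B \<inter> H" "(A - B) \<inter> H"] that
      by (subst signed_measure_Un[OF \<rho>, symmetric]) (auto intro!: arg_cong[where f=\<rho>])
    moreover have "\<rho> (B - H) \<le> 0" "0 \<le> \<rho> ((A - B) \<inter> H)"
      by (auto intro: pos neg)
    ultimately show ?thesis by simp
  qed
  have SUP: "(SUP B\<in>{B \<in> sets borel. B \<subseteq> A}. ennreal (\<rho> B)) = ennreal (\<rho> (A \<inter> H))"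
    if "A \<in> sets borel" for A
    using that by (intro antisym SUP_least SUP_upper ennreal_leI) (auto intro: mono)
  have "sigma_algebra (UNIV :: 'a set) (sets borel)"
    using sets.sigma_algebra_axioms[of borel] by simp
  then show ?thesis
    unfolding pos_part_def
  proof (subst emeasure_measure_of_sigma)
    let ?\<mu> = "\<lambda>A. SUP B\<in>{B \<in> sets borel. B \<subseteq> A}. ennreal (\<rho> B)"
    show "positive (sets borel) ?\<mu>"
      using \<rho> by (simp add: positive_def signed_measure_def SUP)
    show "countably_additive (sets borel) ?\<mu>"
    proof (rule countably_additiveI)
      fix F :: "nat \<Rightarrow> 'a set" assume F: "range F \<subseteq> sets borel" "disjoint_family F" "(\<Union>i. F i) \<in> sets borel"
      have "range (\<lambda>i. F i \<inter> H) \<subseteq> sets borel" using F by auto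
      moreover have "disjoint_family (\<lambda>i. F i \<inter> H)"
        using F by (auto simp: disjoint_family_on_def)
      ultimately have "(\<lambda>i. \<rho> (F i \<inter> H)) sums \<rho> (\<Union>i. F i \<inter> H)"
        using \<rho> unfolding signed_measure_def by metis
      then have "(\<Sum>i. ennreal (\<rho> (F i \<inter> H))) = ennreal (\<rho> ((\<Union>i. F i) \<inter> H))"
        using F by (intro suminf_ennreal_eq pos) auto
      then show "(\<Sum>i. ?\<mu> (F i)) = ?\<mu> (\<Union>i. F i)"
        using F by (simp add: SUP image_subset_iff)
    qed
  qed (use A SUP in auto)
qed

lemma emeasure_total_variation:
  assumes A: "A \<in> sets borel"
  shows "emeasure (total_variation \<rho>) A = emeasure (pos_part \<rho>) A + emeasure (neg_part \<rho>) A"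
  unfolding total_variation_def
proof (rule emeasure_measure_of_sigma)
  show "sigma_algebra (UNIV :: 'a set) (sets borel)"
    using sets.sigma_algebra_axioms[of borel] by simp
  show "countably_additive (sets borel) (\<lambda>A. emeasure (pos_part \<rho>) A + emeasure (neg_part \<rho>) A)"
    by (auto simp: countably_additive_def suminf_add[symmetric] suminf_emeasure)
qed (use A in \<open>auto simp: positive_def\<close>)

text \<open>Padding with the null measure makes additivity of the integral in the measure a case of
  the identity for four measures.\<close>

lemma nn_integral_total_variation:
  assumes "f \<in> borel_measurable borel"
  shows "(\<integral>\<^sup>+x. f x \<partial>total_variation \<rho>) = (\<integral>\<^sup>+x. f x \<partial>pos_part \<rho>) + (\<integral>\<^sup>+x. f x \<partial>neg_part \<rho>)"
  using nn_integral_add_measure_cong[of "null_measure borel" "total_variation \<rho>" "pos_part \<rho>" "neg_part \<rho>" f]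
    assms by (simp add: emeasure_total_variation)

text \<open>M and N may overlap, so they dominate the Jordan parts of \<rho> instead of being equal
  to them. They will be kP and kQ.\<close>

locale measure_difference = M: finite_measure M + N: finite_measure N
  for M N :: "'a::topological_space measure" +
  fixes \<rho> :: "'a set \<Rightarrow> real"
  assumes sets_M [measurable_cong]: "sets M = sets borel"
    and sets_N [measurable_cong]: "sets N = sets borel"
    and diff: "\<And>A. A \<in> sets borel \<Longrightarrow> \<rho> A = measure M A - measure N A"
begin

lemma signed_measure: "signed_measure \<rho>"
  unfolding signed_measure_def
proof safe
  show "\<rho> {} = 0" by (simp add: diff)
  fix A :: "nat \<Rightarrow> 'a set" assume A: "range A \<subseteq> sets borel" "disjoint_family A"
  then have "(\<lambda>i. measure M (A i) - measure N (A i)) sums (measure M (\<Union>i. A i) - measure N (\<Union>i. A i))"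
    by (intro sums_diff M.finite_measure_UNION N.finite_measure_UNION) (auto simp: sets_M sets_N)
  with A show "(\<lambda>i. \<rho> (A i)) sums \<rho> (\<Union>i. A i)"
    by (subst diff, blast) (simp add: diff image_subset_iff)
qed

text \<open>One Hahn set serves both parts, since its complement is a Hahn set for -\<rho>. All
  values are finite, so the claims can be checked in the reals after splitting A along H.\<close>

lemma Jordan_decomposition:
  assumes A: "A \<in> sets borel"
  shows emeasure_pos_part_le: "emeasure (pos_part \<rho>) A \<le> emeasure M A"
    and emeasure_neg_part_le: "emeasure (neg_part \<rho>) A \<le> emeasure N A"
    and Jordan_balance: "emeasure (pos_part \<rho>) A + emeasure N A = emeasure (neg_part \<rho>) A + emeasure M A"
proof -
  obtain H where H: "H \<in> sets borel"
    and pos: "\<And>X. X \<in> sets borel \<Longrightarrow> X \<subseteq> H \<Longrightarrow> emeasure N X \<le> emeasure M X"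
    and neg: "\<And>X. X \<in> sets borel \<Longrightarrow> X \<inter> H = {} \<Longrightarrow> emeasure M X \<le> emeasure N X"
    using finite_unsigned_Hahn_decomposition[OF M.finite_measure_axioms N.finite_measure_axioms]
    unfolding sets_M sets_N by auto
  have pos': "0 \<le> \<rho> X" if "X \<in> sets borel" "X \<subseteq> H" for X
    using pos[OF that] that by (simp add: diff M.emeasure_eq_measure N.emeasure_eq_measure)
  have neg': "\<rho> X \<le> 0" if "X \<in> sets borel" "X \<inter> H = {}" for X
    using neg[OF that] that by (simp add: diff M.emeasure_eq_measure N.emeasure_eq_measure)
  have p: "emeasure (pos_part \<rho>) A = ennreal (\<rho> (A \<inter> H))"
    by (rule emeasure_pos_part[OF signed_measure H pos' neg' A])
  have n: "emeasure (neg_part \<rho>) A = ennreal (- \<rho> (A \<inter> - H))"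
    unfolding neg_part_def
    by (rule emeasure_pos_part[OF signed_measure_uminus[OF signed_measure] _ _ _ A])
      (use H in \<open>auto intro!: pos' neg'\<close>)
  have split: "measure K A = measure K (A \<inter> H) + measure K (A \<inter> - H)"
    if "finite_measure K" "sets K = sets borel" for K
    using that H A by (subst finite_measure.finite_measure_Union[symmetric]) (auto intro!: arg_cong[where f="measure K"])
  have b: "A \<inter> H \<in> sets borel" "A \<inter> - H \<in> sets borel" using A H by auto
  note splits = split[OF M.finite_measure_axioms sets_M] split[OF N.finite_measure_axioms sets_N]
  have s: "0 \<le> \<rho> (A \<inter> H)" "\<rho> (A \<inter> - H) \<le> 0" using b by (auto intro!: pos' neg')
  note e = M.emeasure_eq_measure N.emeasure_eq_measure
  show "emeasure (pos_part \<rho>) A \<le> emeasure M A"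
    unfolding p e splits using b by (intro ennreal_leI) (simp add: diff add_increasing2)
  show "emeasure (neg_part \<rho>) A \<le> emeasure N A"
    unfolding n e splits using b by (intro ennreal_leI) (simp add: diff add_increasing)
  show "emeasure (pos_part \<rho>) A + emeasure N A = emeasure (neg_part \<rho>) A + emeasure M A"
    unfolding p n e using s b by (simp add: ennreal_plus[symmetric] splits diff del: ennreal_plus)
qed

lemma nn_integral_pos_part_le: "(\<integral>\<^sup>+x. f x \<partial>pos_part \<rho>) \<le> (\<integral>\<^sup>+x. f x \<partial>M)"
  by (intro nn_integral_mono_measure) (auto simp: sets_M le_measure emeasure_pos_part_le)

lemma nn_integral_neg_part_le: "(\<integral>\<^sup>+x. f x \<partial>neg_part \<rho>) \<le> (\<integral>\<^sup>+x. f x \<partial>N)"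
  by (intro nn_integral_mono_measure) (auto simp: sets_N le_measure emeasure_neg_part_le)

lemma nn_integral_balance:
  assumes "f \<in> borel_measurable borel"
  shows "(\<integral>\<^sup>+x. f x \<partial>pos_part \<rho>) + (\<integral>\<^sup>+x. f x \<partial>N) = (\<integral>\<^sup>+x. f x \<partial>neg_part \<rho>) + (\<integral>\<^sup>+x. f x \<partial>M)"
  using assms by (intro nn_integral_add_measure_cong) (auto simp: sets_M sets_N Jordan_balance)

text \<open>Domination of the Jordan parts by M and N gives integrability. For the value, the
  balance of nonnegative integrals is moved to the reals, where all four terms are finite and can be
  rearranged.\<close>

lemma
  assumes f: "integrable M f" "integrable N f"
  shows signed_integrable: "signed_integrable \<rho> f"
    and signed_integral_nonneg: "(\<And>x. 0 \<le> f x) \<Longrightarrow> signed_integral \<rho> f = (\<integral>x. f x \<partial>M) - (\<integral>x. f x \<partial>N)"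
proof -
  have m [measurable]: "f \<in> borel_measurable borel"
    using borel_measurable_integrable[OF f(1)] by (simp cong: measurable_cong_sets add: sets_M)
  have int: "integrable (pos_part \<rho>) f" "integrable (neg_part \<rho>) f"
    using f le_less_trans[OF nn_integral_pos_part_le] le_less_trans[OF nn_integral_neg_part_le]
    unfolding integrable_iff_bounded by auto
  then show "signed_integrable \<rho> f" by (simp add: signed_integrable_def)
  assume nn: "\<And>x. 0 \<le> f x"
  have e: "(\<integral>\<^sup>+x. ennreal (f x) \<partial>K) = ennreal (\<integral>x. f x \<partial>K)" if "integrable K f" for K
    using that nn by (intro nn_integral_eq_integral) auto
  have "ennreal ((\<integral>x. f x \<partial>pos_part \<rho>) + (\<integral>x. f x \<partial>N)) = ennreal ((\<integral>x. f x \<partial>neg_part \<rho>) + (\<integral>x. f x \<partial>M))"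
    using nn_integral_balance[of "\<lambda>x. ennreal (f x)"] nn by (simp add: e int f)
  then have "(\<integral>x. f x \<partial>pos_part \<rho>) + (\<integral>x. f x \<partial>N) = (\<integral>x. f x \<partial>neg_part \<rho>) + (\<integral>x. f x \<partial>M)"
    using nn by (subst (asm) ennreal_inj) (auto intro!: add_nonneg_nonneg integral_nonneg)
  then show "signed_integral \<rho> f = (\<integral>x. f x \<partial>M) - (\<integral>x. f x \<partial>N)"
    by (simp add: signed_integral_def)
qed

end

subsection \<open>Admissible perturbations\<close>

definition finite_moment_probs :: "'a::euclidean_space measure set" where
  "finite_moment_probs = {P \<in> borel_probs. integrable P norm}"

lemma borel_probsD:
  assumes "P \<in> borel_probs"
  shows "prob_space P" "sets P = sets borel" "space P = UNIV"
  using assms sets_eq_imp_space_eq[of P borel] by (auto simp: borel_probs_def)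

lemma measurable_borel_probs:
  "P \<in> borel_probs \<Longrightarrow> f \<in> measurable borel N \<Longrightarrow> f \<in> measurable P N"
  using borel_probsD(2)[of P] by (simp cong: measurable_cong_sets)

lemma finite_momentI:
  assumes "P \<in> borel_probs" "(\<integral>\<^sup>+x. ennreal (norm x) \<partial>P) < \<infinity>"
  shows "P \<in> finite_moment_probs"
  using assms measurable_borel_probs[OF assms(1), of norm borel]
  by (simp add: finite_moment_probs_def integrable_iff_bounded)

lemma finite_momentD:
  assumes "P \<in> finite_moment_probs"
  shows "P \<in> borel_probs" "(\<integral>\<^sup>+x. ennreal (norm x) \<partial>P) < \<infinity>"
  using assms unfolding finite_moment_probs_def by (auto simp: integrable_iff_bounded)

text \<open>\<open>perturb\<close> feeds \<open>measure_of\<close> a set function that may fail to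
  be a measure. Exhibiting a probability measure with the same values rules out this degenerate case
  and identifies the result.\<close>

lemma perturb_eqI:
  assumes R: "R \<in> borel_probs" and eq: "\<And>A. A \<in> sets borel \<Longrightarrow> measure R A = measure Q A + \<epsilon> * \<rho> A"
  shows "perturb Q \<epsilon> \<rho> = R"
proof -
  interpret R: prob_space R by (rule borel_probsD[OF R])
  have "perturb Q \<epsilon> \<rho> = measure_of (space R) (sets R) (emeasure R)"
    unfolding perturb_def borel_probsD[OF R]
    by (intro measure_of_eq) (auto simp: R.emeasure_eq_measure eq sets.sigma_sets_eq[of borel, simplified])
  then show ?thesis by (simp add: measure_of_of_measure)
qed

lemma perturb_probD:
  assumes "perturb_prob Q \<epsilon> \<rho>"
  shows "perturb Q \<epsilon> \<rho> \<in> borel_probs"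
    and "A \<in> sets borel \<Longrightarrow> measure (perturb Q \<epsilon> \<rho>) A = measure Q A + \<epsilon> * \<rho> A"
proof -
  obtain P where P: "P \<in> borel_probs" "\<And>A. A \<in> sets borel \<Longrightarrow> measure P A = measure Q A + \<epsilon> * \<rho> A"
    using assms unfolding perturb_prob_def by blast
  then have "perturb Q \<epsilon> \<rho> = P" by (rule perturb_eqI)
  with P show "perturb Q \<epsilon> \<rho> \<in> borel_probs"
    "A \<in> sets borel \<Longrightarrow> measure (perturb Q \<epsilon> \<rho>) A = measure Q A + \<epsilon> * \<rho> A" by simp_all
qed

lemma measure_difference_scaled:
  assumes P: "P \<in> borel_probs" and Q: "Q \<in> borel_probs" and k: "0 \<le> k"
    and \<rho>: "\<And>A. A \<in> sets borel \<Longrightarrow> \<rho> A = k * (measure P A - measure Q A)"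
  shows "measure_difference (scale_measure (ennreal k) P) (scale_measure (ennreal k) Q) \<rho>"
proof -
  interpret P: prob_space P by (rule borel_probsD[OF P])
  interpret Q: prob_space Q by (rule borel_probsD[OF Q])
  show ?thesis
  proof (intro measure_difference.intro measure_difference_axioms.intro finite_measureI)
    show "emeasure (scale_measure (ennreal k) P) (space (scale_measure (ennreal k) P)) \<noteq> \<infinity>"
      "emeasure (scale_measure (ennreal k) Q) (space (scale_measure (ennreal k) Q)) \<noteq> \<infinity>"
      by (simp_all add: ennreal_mult_eq_top_iff space_scale_measure)
    show "sets (scale_measure (ennreal k) P) = sets borel" "sets (scale_measure (ennreal k) Q) = sets borel"
      by (simp_all add: borel_probsD(2)[OF P] borel_probsD(2)[OF Q])
    show "\<rho> A = measure (scale_measure (ennreal k) P) A - measure (scale_measure (ennreal k) Q) A"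
      if "A \<in> sets borel" for A
      using \<rho>[OF that] k by (simp add: right_diff_distrib)
  qed
qed

lemma integral_scale_measure:
  fixes f :: "'a \<Rightarrow> real"
  assumes "integrable P f" "\<And>x. 0 \<le> f x" "0 \<le> k"
  shows "integrable (scale_measure (ennreal k) P) f"
    and "(\<integral>x. f x \<partial>scale_measure (ennreal k) P) = k * (\<integral>x. f x \<partial>P)"
proof -
  have "(\<integral>\<^sup>+x. ennreal (f x) \<partial>scale_measure (ennreal k) P) = ennreal (k * (\<integral>x. f x \<partial>P))"
    using assms by (subst nn_integral_scale_measure) (auto simp: nn_integral_eq_integral ennreal_mult)
  moreover have "f \<in> borel_measurable (scale_measure (ennreal k) P)"
    using assms by (simp cong: measurable_cong_sets)
  ultimately show "integrable (scale_measure (ennreal k) P) f"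
    "(\<integral>x. f x \<partial>scale_measure (ennreal k) P) = k * (\<integral>x. f x \<partial>P)"
    using assms by (auto intro!: integrableI_nonneg integral_eq_nn_integral[THEN trans]
        simp: integral_eq_nn_integral)
qed

lemma
  assumes P: "P \<in> borel_probs" and Q: "Q \<in> borel_probs" and k: "0 \<le> k"
    and \<rho>: "\<And>A. A \<in> sets borel \<Longrightarrow> \<rho> A = k * (measure P A - measure Q A)"
    and f: "integrable P f" "integrable Q f" "\<And>x. 0 \<le> f x"
  shows signed_integrable_difference: "signed_integrable \<rho> f"
    and signed_integral_difference: "signed_integral \<rho> f = k * ((\<integral>x. f x \<partial>P) - (\<integral>x. f x \<partial>Q))"
proof -
  interpret measure_difference "scale_measure (ennreal k) P" "scale_measure (ennreal k) Q" \<rho>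
    by (rule measure_difference_scaled[OF P Q k \<rho>])
  note i = integral_scale_measure[OF f(1,3) k] integral_scale_measure[OF f(2,3) k]
  show "signed_integrable \<rho> f" by (rule signed_integrable[OF i(1,3)])
  show "signed_integral \<rho> f = k * ((\<integral>x. f x \<partial>P) - (\<integral>x. f x \<partial>Q))"
    using signed_integral_nonneg[OF i(1,3) f(3)] by (simp add: i right_diff_distrib)
qed

text \<open>The coupling draws \<open>(x, y)\<close> from \<open>P \<Otimes> Q\<close> and replaces \<open>x\<close> by \<open>y\<close> with probability \<open>1 - s\<close>.\<close>

lemma mixture_coupling:
  fixes P Q :: "'a::euclidean_space measure"
  assumes P: "P \<in> borel_probs" and Q: "Q \<in> borel_probs" and s: "0 \<le> s" "s \<le> 1"
  obtains R where "R \<in> borel_probs"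
    and "\<And>A. A \<in> sets borel \<Longrightarrow> measure R A = measure Q A + s * (measure P A - measure Q A)"
    and "wasserstein1 R Q \<le> ennreal s * (\<integral>\<^sup>+z. ennreal (dist (fst z) (snd z)) \<partial>(P \<Otimes>\<^sub>M Q))"
proof -
  interpret P: prob_space P by (rule borel_probsD[OF P])
  interpret Q: prob_space Q by (rule borel_probsD[OF Q])
  interpret PQ: pair_prob_space P Q ..
  note [measurable_cong] = borel_probsD(2)[OF P] borel_probsD(2)[OF Q]
  let ?B = "measure_pmf (bernoulli_pmf s)"
  define Z where "Z = ?B \<Otimes>\<^sub>M (P \<Otimes>\<^sub>M Q)"
  interpret BZ: pair_prob_space ?B "P \<Otimes>\<^sub>M Q" ..
  have pZ: "prob_space Z" unfolding Z_def by (rule BZ.prob_space_axioms)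
  define T where "T = (\<lambda>z::bool \<times> 'a \<times> 'a. (if fst z then fst (snd z) else snd (snd z), snd (snd z)))"
  have T [measurable]: "T \<in> measurable Z (borel \<Otimes>\<^sub>M borel)"
    unfolding T_def Z_def by measurable
  define \<pi> where "\<pi> = distr Z (borel \<Otimes>\<^sub>M borel) T"
  have p\<pi>: "prob_space \<pi>"
    unfolding \<pi>_def by (rule prob_space.prob_space_distr[OF pZ T])
  define R where "R = distr \<pi> borel fst"
  \<comment> \<open>Conditioning on the coin. Everything about \<pi> is read off this formula:
    indicators of either coordinate give the marginals, and for the distance the diagonal term
    vanishes, which leaves the factor s.\<close>
  have nn: "(\<integral>\<^sup>+z. f z \<partial>\<pi>) = (\<integral>\<^sup>+z. f z \<partial>(P \<Otimes>\<^sub>M Q)) * s + (\<integral>\<^sup>+y. f (y, y) \<partial>Q) * (1 - s)"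
    if f [measurable]: "f \<in> borel_measurable (borel \<Otimes>\<^sub>M borel)" for f :: "'a \<times> 'a \<Rightarrow> ennreal"
  proof -
    have "(\<integral>\<^sup>+z. f z \<partial>\<pi>) = (\<integral>\<^sup>+z. f (T z) \<partial>Z)"
      unfolding \<pi>_def by (rule nn_integral_distr) auto
    also have "\<dots> = (\<integral>\<^sup>+b. (\<integral>\<^sup>+z. f (T (b, z)) \<partial>(P \<Otimes>\<^sub>M Q)) \<partial>?B)"
      using measurable_compose[OF T f] unfolding Z_def by (rule PQ.nn_integral_fst[symmetric])
    also have "\<dots> = (\<integral>\<^sup>+z. f (T (True, z)) \<partial>(P \<Otimes>\<^sub>M Q)) * s + (\<integral>\<^sup>+z. f (T (False, z)) \<partial>(P \<Otimes>\<^sub>M Q)) * (1 - s)"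
      using s by (intro nn_integral_bernoulli_pmf) auto
    also have "(\<integral>\<^sup>+z. f (T (True, z)) \<partial>(P \<Otimes>\<^sub>M Q)) = (\<integral>\<^sup>+z. f z \<partial>(P \<Otimes>\<^sub>M Q))"
      by (simp add: T_def)
    also have "(\<integral>\<^sup>+z. f (T (False, z)) \<partial>(P \<Otimes>\<^sub>M Q)) = (\<integral>\<^sup>+x. (\<integral>\<^sup>+y. f (y, y) \<partial>Q) \<partial>P)"
      by (subst Q.nn_integral_fst[symmetric]) (auto simp: T_def)
    also have "\<dots> = (\<integral>\<^sup>+y. f (y, y) \<partial>Q)"
      by (simp add: P.emeasure_space_1)
    finally show ?thesis .
  qed
  have marginal: "emeasure (distr \<pi> borel F) A = (\<integral>\<^sup>+z. indicator A (F z) \<partial>\<pi>)"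
    if "F \<in> borel_measurable (borel \<Otimes>\<^sub>M borel)" and A: "A \<in> sets borel" for F :: "'a \<times> 'a \<Rightarrow> 'a" and A
  proof -
    have "emeasure (distr \<pi> borel F) A = (\<integral>\<^sup>+x. indicator A x \<partial>distr \<pi> borel F)"
      using A by simp
    also have "\<dots> = (\<integral>\<^sup>+z. indicator A (F z) \<partial>\<pi>)"
      using that by (intro nn_integral_distr) (auto simp: \<pi>_def)
    finally show ?thesis .
  qed
  have R: "R \<in> borel_probs"
    unfolding R_def borel_probs_def \<pi>_def
    by (auto intro!: prob_space.prob_space_distr[OF p\<pi>[unfolded \<pi>_def]])
  interpret R: prob_space R by (rule borel_probsD[OF R])
  have "measure R A = measure Q A + s * (measure P A - measure Q A)" if A: "A \<in> sets borel" for A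
  proof -
    have "emeasure R A = (\<integral>\<^sup>+z. indicator A (fst z) \<partial>\<pi>)"
      unfolding R_def using A by (intro marginal) auto
    also have "\<dots> = (\<integral>\<^sup>+z. indicator A (fst z) \<partial>(P \<Otimes>\<^sub>M Q)) * s + emeasure Q A * (1 - s)"
      using A by (subst nn) (auto simp: borel_probsD[OF Q])
    also have "(\<integral>\<^sup>+z. indicator A (fst z) \<partial>(P \<Otimes>\<^sub>M Q)) = (\<integral>\<^sup>+x. (\<integral>\<^sup>+y. indicator A x \<partial>Q) \<partial>P)"
      using A by (subst Q.nn_integral_fst[symmetric]) auto
    also have "\<dots> = emeasure P A"
      using A by (simp add: Q.emeasure_space_1 borel_probsD[OF P])
    finally have "ennreal (measure R A) = ennreal (measure P A * s + measure Q A * (1 - s))"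
      using s by (simp add: R.emeasure_eq_measure P.emeasure_eq_measure Q.emeasure_eq_measure
          ennreal_plus[symmetric] ennreal_mult''[symmetric] del: ennreal_plus)
    then have "measure R A = measure P A * s + measure Q A * (1 - s)"
      using s by (subst (asm) ennreal_inj) auto
    then show ?thesis by (simp add: algebra_simps)
  qed
  moreover have "wasserstein1 R Q \<le> ennreal s * (\<integral>\<^sup>+z. ennreal (dist (fst z) (snd z)) \<partial>(P \<Otimes>\<^sub>M Q))"
  proof -
    have "distr \<pi> borel snd = Q"
    proof (rule measure_eqI)
      fix A assume "A \<in> sets (distr \<pi> borel snd)"
      then have A: "A \<in> sets borel" by simp
      have "emeasure (distr \<pi> borel snd) A = (\<integral>\<^sup>+z. indicator A (snd z) \<partial>\<pi>)"
        using A by (intro marginal) auto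
      also have "\<dots> = (\<integral>\<^sup>+z. indicator A (snd z) \<partial>(P \<Otimes>\<^sub>M Q)) * s + emeasure Q A * (1 - s)"
        using A by (subst nn) (auto simp: borel_probsD[OF Q])
      also have "(\<integral>\<^sup>+z. indicator A (snd z) \<partial>(P \<Otimes>\<^sub>M Q)) = (\<integral>\<^sup>+x. (\<integral>\<^sup>+y. indicator A y \<partial>Q) \<partial>P)"
        using A by (subst Q.nn_integral_fst[symmetric]) auto
      also have "\<dots> = emeasure Q A"
        using A by (simp add: P.emeasure_space_1 borel_probsD[OF Q])
      also have "emeasure Q A * s + emeasure Q A * (1 - s) = emeasure Q A"
        using s by (simp add: distrib_left[symmetric] ennreal_plus[symmetric] del: ennreal_plus)
      finally show "emeasure (distr \<pi> borel snd) A = emeasure Q A" .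
    qed (simp add: borel_probsD[OF Q])
    then have "\<pi> \<in> couplings R Q"
      by (simp add: couplings_def R_def) (simp add: \<pi>_def)
    then have "wasserstein1 R Q \<le> (\<integral>\<^sup>+z. ennreal (dist (fst z) (snd z)) \<partial>\<pi>)"
      unfolding wasserstein1_def by (rule INF_lower)
    also have "\<dots> = ennreal s * (\<integral>\<^sup>+z. ennreal (dist (fst z) (snd z)) \<partial>(P \<Otimes>\<^sub>M Q))"
      by (subst nn) (auto simp: mult.commute)
    finally show ?thesis .
  qed
  ultimately show ?thesis using R that by blast
qed

lemma product_dist_finite:
  fixes P Q :: "'a::euclidean_space measure"
  assumes P: "P \<in> finite_moment_probs" and Q: "Q \<in> finite_moment_probs"
  shows "(\<integral>\<^sup>+z. ennreal (dist (fst z) (snd z)) \<partial>(P \<Otimes>\<^sub>M Q)) < \<infinity>"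
proof -
  note P' = finite_momentD[OF P] and Q' = finite_momentD[OF Q]
  interpret P: prob_space P by (rule borel_probsD[OF P'(1)])
  interpret Q: prob_space Q by (rule borel_probsD[OF Q'(1)])
  note [measurable_cong] = borel_probsD(2)[OF P'(1)] borel_probsD(2)[OF Q'(1)]
  have "(\<integral>\<^sup>+z. ennreal (dist (fst z) (snd z)) \<partial>(P \<Otimes>\<^sub>M Q))
      \<le> (\<integral>\<^sup>+z. ennreal (norm (fst z)) + ennreal (norm (snd z)) \<partial>(P \<Otimes>\<^sub>M Q))"
    by (intro nn_integral_mono) (auto simp: ennreal_plus[symmetric] dist_norm norm_triangle_ineq4 simp del: ennreal_plus)
  also have "\<dots> = (\<integral>\<^sup>+x. \<integral>\<^sup>+y. ennreal (norm x) + ennreal (norm y) \<partial>Q \<partial>P)"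
    by (subst Q.nn_integral_fst[symmetric]) auto
  also have "\<dots> = (\<integral>\<^sup>+x. ennreal (norm x) \<partial>P) + (\<integral>\<^sup>+y. ennreal (norm y) \<partial>Q)"
    by (simp add: nn_integral_add P.emeasure_space_1 Q.emeasure_space_1)
  finally show ?thesis
    using P' Q' by (simp add: less_top[symmetric] top_unique) (auto simp: top_unique)
qed

text \<open>Here Q + t\<rho> = (1 - tk) Q + tk P, which is a mixture as long as tk is at most
  1.\<close>

lemma perturb_prob_segment:
  assumes P: "P \<in> borel_probs" and Q: "Q \<in> borel_probs" and k: "0 < k" and t: "0 \<le> t" "t \<le> 1 / k"
    and \<rho>: "\<And>A. A \<in> sets borel \<Longrightarrow> \<rho> A = k * (measure P A - measure Q A)"
  shows "perturb_prob Q t \<rho>"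
    and "wasserstein1 (perturb Q t \<rho>) Q \<le> ennreal (t * k) * (\<integral>\<^sup>+z. ennreal (dist (fst z) (snd z)) \<partial>(P \<Otimes>\<^sub>M Q))"
proof -
  have "0 \<le> t * k" "t * k \<le> 1" using k t by (auto simp: field_simps)
  from mixture_coupling[OF P Q this] obtain R where R: "R \<in> borel_probs"
    and m: "\<And>A. A \<in> sets borel \<Longrightarrow> measure R A = measure Q A + t * k * (measure P A - measure Q A)"
    and w: "wasserstein1 R Q \<le> ennreal (t * k) * (\<integral>\<^sup>+z. ennreal (dist (fst z) (snd z)) \<partial>(P \<Otimes>\<^sub>M Q))"
    by blast
  have m': "measure R A = measure Q A + t * \<rho> A" if "A \<in> sets borel" for A
    using m[OF that] \<rho>[OF that] by simp
  then show "perturb_prob Q t \<rho>" using R by (auto simp: perturb_prob_def)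
  show "wasserstein1 (perturb Q t \<rho>) Q \<le> ennreal (t * k) * (\<integral>\<^sup>+z. ennreal (dist (fst z) (snd z)) \<partial>(P \<Otimes>\<^sub>M Q))"
    using w perturb_eqI[OF R m'] by simp
qed

section \<open>Admissible directions as multiples of differences of probability measures\<close>

text \<open>The total variation of \<rho> is bounded by kP + kQ, and short steps from Q stay on the
  segment towards P.\<close>

lemma right_admissible_difference:
  assumes P: "P \<in> finite_moment_probs" and Q: "Q \<in> finite_moment_probs" and k: "0 < k"
    and \<rho>: "\<And>A. A \<in> sets borel \<Longrightarrow> \<rho> A = k * (measure P A - measure Q A)"
  shows "right_admissible Q \<rho>"
proof -
  note P' = finite_momentD[OF P] and Q' = finite_momentD[OF Q]
  interpret P: prob_space P by (rule borel_probsD[OF P'(1)])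
  interpret Q: prob_space Q by (rule borel_probsD[OF Q'(1)])
  let ?M = "scale_measure (ennreal k) P" and ?N = "scale_measure (ennreal k) Q"
  interpret measure_difference ?M ?N \<rho>
    using k by (intro measure_difference_scaled P' Q' \<rho>) auto
  have fin: "(\<integral>\<^sup>+x. ennreal (f x) \<partial>total_variation \<rho>) < \<infinity>"
    if [measurable]: "f \<in> borel_measurable borel"
      and f: "(\<integral>\<^sup>+x. ennreal (f x) \<partial>P) < \<infinity>" "(\<integral>\<^sup>+x. ennreal (f x) \<partial>Q) < \<infinity>" for f :: "'a \<Rightarrow> real"
  proof -
    have "(\<integral>\<^sup>+x. ennreal (f x) \<partial>total_variation \<rho>) \<le> (\<integral>\<^sup>+x. ennreal (f x) \<partial>?M) + (\<integral>\<^sup>+x. ennreal (f x) \<partial>?N)"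
      by (simp add: nn_integral_total_variation add_mono nn_integral_pos_part_le nn_integral_neg_part_le)
    also have "\<dots> = k * (\<integral>\<^sup>+x. ennreal (f x) \<partial>P) + k * (\<integral>\<^sup>+x. ennreal (f x) \<partial>Q)"
      by (simp add: nn_integral_scale_measure measurable_borel_probs P' Q')
    also have "\<dots> < \<infinity>"
      using f by (simp add: ennreal_mult_less_top)
    finally show ?thesis .
  qed
  have "\<rho> UNIV = 0"
    using \<rho>[of UNIV] P.prob_space Q.prob_space borel_probsD(3)[OF P'(1)] borel_probsD(3)[OF Q'(1)] by simp
  moreover have "emeasure (total_variation \<rho>) UNIV < \<infinity>"
    using fin[of "\<lambda>_. 1"] sets_eq_imp_space_eq[OF sets_total_variation, of \<rho>]
    by (simp add: P.emeasure_space_1 Q.emeasure_space_1)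
  moreover have "\<forall>\<^sub>F \<epsilon> in at_right 0. perturb_prob Q \<epsilon> \<rho>"
    using k by (auto simp: eventually_at_right[of 0 1] intro!: exI[of _ "1 / k"]
        perturb_prob_segment[OF P'(1) Q'(1) k _ _ \<rho>])
  ultimately show ?thesis
    unfolding right_admissible_def using signed_measure fin[of norm] P' Q' by auto
qed

text \<open>Writing \<rho> as the difference of the perturbed measure and Q, both divided by
  \<epsilon>, the balance identity dominates the former by \<open>pos_part \<rho>\<close> plus the
  latter. Both of these have finite first moment.\<close>

lemma finite_moment_perturb:
  assumes Q: "Q \<in> finite_moment_probs" and \<rho>: "right_admissible Q \<rho>"
    and \<epsilon>: "0 < \<epsilon>" "perturb_prob Q \<epsilon> \<rho>"
  shows "perturb Q \<epsilon> \<rho> \<in> finite_moment_probs"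
    and "A \<in> sets borel \<Longrightarrow> \<rho> A = 1 / \<epsilon> * (measure (perturb Q \<epsilon> \<rho>) A - measure Q A)"
proof -
  let ?P = "perturb Q \<epsilon> \<rho>"
  note Q' = finite_momentD[OF Q]
  note P = perturb_probD[OF \<epsilon>(2)]
  show eq: "\<rho> A = 1 / \<epsilon> * (measure ?P A - measure Q A)" if "A \<in> sets borel" for A
    using P(2)[OF that] \<epsilon>(1) by simp
  let ?M = "scale_measure (ennreal (1 / \<epsilon>)) ?P" and ?N = "scale_measure (ennreal (1 / \<epsilon>)) Q"
  interpret measure_difference ?M ?N \<rho>
    using \<epsilon> by (intro measure_difference_scaled P Q' eq) auto
  have fin: "(\<integral>\<^sup>+x. ennreal (norm x) \<partial>total_variation \<rho>) < \<infinity>"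
    using \<rho> by (simp add: right_admissible_def)
  have "ennreal (1 / \<epsilon>) * (\<integral>\<^sup>+x. ennreal (norm x) \<partial>?P) = (\<integral>\<^sup>+x. ennreal (norm x) \<partial>?M)"
    by (simp add: nn_integral_scale_measure measurable_borel_probs P)
  also have "\<dots> \<le> (\<integral>\<^sup>+x. ennreal (norm x) \<partial>pos_part \<rho>) + (\<integral>\<^sup>+x. ennreal (norm x) \<partial>?N)"
    by (simp add: nn_integral_balance)
  also have "\<dots> < \<infinity>"
    using fin Q' by (simp add: nn_integral_total_variation nn_integral_scale_measure measurable_borel_probs
        ennreal_mult_less_top)
  finally show "?P \<in> finite_moment_probs"
    using P \<epsilon> by (intro finite_momentI) (auto simp: ennreal_mult_less_top)
qed

text \<open>One sufficiently small \<epsilon> is enough: take P = Q + \<epsilon>\<rho> and k = 1 /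
  \<epsilon>.\<close>

lemma right_admissibleE:
  assumes Q: "Q \<in> finite_moment_probs" and \<rho>: "right_admissible Q \<rho>"
  obtains P k where "P \<in> finite_moment_probs" "0 < k"
    "\<And>A. A \<in> sets borel \<Longrightarrow> \<rho> A = k * (measure P A - measure Q A)"
proof -
  have "\<forall>\<^sub>F \<epsilon> in at_right 0. perturb_prob Q \<epsilon> \<rho> \<and> 0 < \<epsilon>"
    using \<rho> by (auto simp: right_admissible_def eventually_conj_iff eventually_at_right_less)
  then obtain \<epsilon> where "perturb_prob Q \<epsilon> \<rho>" "0 < \<epsilon>"
    using eventually_happens'[OF trivial_limit_at_right_real] by blast
  with finite_moment_perturb[OF Q \<rho>, of \<epsilon>] that[of "perturb Q \<epsilon> \<rho>" "1 / \<epsilon>"] show ?thesis by auto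
qed

subsection \<open>Directional derivatives of CVaR\<close>

locale lipschitz_cvar =
  fixes g :: "'a::euclidean_space \<Rightarrow> real" and \<alpha> L :: real
  assumes lipschitz: "L-lipschitz_on UNIV g"
    and alpha: "0 < \<alpha>" "\<alpha> < 1"
begin

lemma L_nonneg: "0 \<le> L"
  using lipschitz by (rule lipschitz_on_nonneg)

lemma g_measurable [measurable]: "g \<in> borel_measurable borel"
  using lipschitz_on_continuous_on[OF lipschitz] by (rule borel_measurable_continuous_onI)

lemma excess_measurable [measurable]: "excess \<alpha> g y \<in> borel_measurable borel"
  unfolding excess_def[abs_def] by measurable

lemma excess_nonneg: "0 \<le> excess \<alpha> g y x"
  using alpha by (simp add: excess_def)

lemma excess_lipschitz: "\<bar>excess \<alpha> g y x - excess \<alpha> g y x'\<bar> \<le> L / (1 - \<alpha>) * dist x x'"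
proof -
  have "\<bar>excess \<alpha> g y x - excess \<alpha> g y x'\<bar> \<le> \<bar>g x - g x'\<bar> / (1 - \<alpha>)"
    using alpha unfolding excess_def diff_divide_distrib[symmetric] abs_divide
    by (auto intro!: divide_right_mono)
  also have "\<dots> \<le> (L * dist x x') / (1 - \<alpha>)"
    using alpha lipschitz_onD[OF lipschitz, of x x'] by (intro divide_right_mono) (auto simp: dist_real_def)
  finally show ?thesis by simp
qed

lemma cvar_problem:
  assumes "P \<in> finite_moment_probs" shows "cvar_problem P g \<alpha>"
proof -
  note P = finite_momentD[OF assms]
  interpret P: prob_space P by (rule borel_probsD[OF P(1)])
  have "integrable P norm" using assms by (simp add: finite_moment_probs_def)
  then have "integrable P (\<lambda>x. \<bar>g 0\<bar> + L * norm x)" by auto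
  then have "integrable P g"
  proof (rule Bochner_Integration.integrable_bound)
    have "\<bar>g x\<bar> \<le> \<bar>g 0\<bar> + L * norm x" for x
      using lipschitz_onD[OF lipschitz, of x 0] by (auto simp: dist_real_def dist_norm)
    then show "AE x in P. norm (g x) \<le> norm (\<bar>g 0\<bar> + L * norm x)"
      using L_nonneg by (auto simp: abs_of_nonneg)
  qed (simp add: measurable_borel_probs P)
  then show ?thesis
    using alpha by unfold_locales
qed

lemma
  assumes P: "P \<in> finite_moment_probs" and Q: "Q \<in> finite_moment_probs" and k: "0 \<le> k"
    and \<rho>: "\<And>A. A \<in> sets borel \<Longrightarrow> \<rho> A = k * (measure P A - measure Q A)"
  shows signed_integrable_excess: "signed_integrable \<rho> (excess \<alpha> g y)"
    and signed_integral_excess: "signed_integral \<rho> (excess \<alpha> g y)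
      = k * ((\<integral>x. excess \<alpha> g y x \<partial>P) - (\<integral>x. excess \<alpha> g y x \<partial>Q))"
  using signed_integrable_difference[OF finite_momentD(1)[OF P] finite_momentD(1)[OF Q] k \<rho>]
    signed_integral_difference[OF finite_momentD(1)[OF P] finite_momentD(1)[OF Q] k \<rho>]
    cvar_problem.integrable_excess[OF cvar_problem[OF P]] cvar_problem.integrable_excess[OF cvar_problem[OF Q]]
    excess_nonneg by auto

lemma signed_integral_excess_lipschitz:
  assumes Q: "Q \<in> finite_moment_probs" and \<rho>: "right_admissible Q \<rho>"
  obtains K where "0 < K"
    "\<And>y z. \<bar>signed_integral \<rho> (excess \<alpha> g y) - signed_integral \<rho> (excess \<alpha> g z)\<bar> \<le> K * \<bar>y - z\<bar>"
proof -
  from right_admissibleE[OF Q \<rho>] obtain P k where P: "P \<in> finite_moment_probs" and k: "0 < k"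
    and eq: "\<And>A. A \<in> sets borel \<Longrightarrow> \<rho> A = k * (measure P A - measure Q A)" by blast
  note I = signed_integral_excess[OF P Q less_imp_le[OF k] eq]
  \<comment> \<open>The integrals against P and Q are each Lipschitz in the threshold with constant
    1 / (1 - \<alpha>); this explains the factor 2, and k comes from \<rho> = k(P - Q).\<close>
  have "\<bar>signed_integral \<rho> (excess \<alpha> g y) - signed_integral \<rho> (excess \<alpha> g z)\<bar> \<le> 2 * k / (1 - \<alpha>) * \<bar>y - z\<bar>" for y z
  proof -
    let ?E = "\<lambda>R y. \<integral>x. excess \<alpha> g y x \<partial>R"
    have "signed_integral \<rho> (excess \<alpha> g y) - signed_integral \<rho> (excess \<alpha> g z)
        = k * ((?E P y - ?E P z) - (?E Q y - ?E Q z))"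
      by (simp add: I algebra_simps)
    then have "\<bar>signed_integral \<rho> (excess \<alpha> g y) - signed_integral \<rho> (excess \<alpha> g z)\<bar>
        = k * \<bar>(?E P y - ?E P z) - (?E Q y - ?E Q z)\<bar>"
      using k by (simp add: abs_mult)
    also have "\<dots> \<le> k * (2 * (\<bar>y - z\<bar> / (1 - \<alpha>)))"
      using cvar_problem.integral_excess_lipschitz[OF cvar_problem[OF P], of y z]
        cvar_problem.integral_excess_lipschitz[OF cvar_problem[OF Q], of y z] k
      by (intro mult_left_mono) linarith+
    finally show ?thesis by (simp add: mult_ac)
  qed
  moreover have "0 < 2 * k / (1 - \<alpha>)" using k alpha by simp
  ultimately show ?thesis using that by blast
qed

text \<open>The expansion in \<epsilon> is exact because the excess integral is affine in the
  measure, so the Danskin argument has no remainder to control.\<close>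

lemma RU_perturb:
  assumes Q: "Q \<in> finite_moment_probs" and \<rho>: "right_admissible Q \<rho>"
    and \<epsilon>: "0 < \<epsilon>" "perturb_prob Q \<epsilon> \<rho>"
  shows "RU \<alpha> g (perturb Q \<epsilon> \<rho>) y = RU \<alpha> g Q y + \<epsilon> * signed_integral \<rho> (excess \<alpha> g y)"
proof -
  note P = finite_moment_perturb[OF Q \<rho> \<epsilon>]
  show ?thesis
    using signed_integral_excess[OF P(1) Q _ P(2), of y] \<epsilon>(1) by (simp add: RU_def)
qed

section \<open>Stability of the quantile and the right derivative\<close>

text \<open>Two thresholds decide: the distribution function is strictly below \<alpha> at the lower
  bound and strictly above at the upper one, and both strict inequalities survive small \<epsilon>.
  The upper bound involves \<open>VaR_upper\<close> because a perturbation may push the quantile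
  across the whole interval.\<close>

lemma eventually_VaR_near:
  assumes Q: "Q \<in> finite_moment_probs" and \<rho>: "right_admissible Q \<rho>" and \<delta>: "0 < \<delta>"
  shows "\<forall>\<^sub>F \<epsilon> in at_right 0. VaR \<alpha> g (perturb Q \<epsilon> \<rho>) \<in> {VaR \<alpha> g Q - \<delta> .. VaR_upper \<alpha> g Q + \<delta>}"
proof -
  interpret Q: cvar_problem Q g \<alpha> by (rule cvar_problem[OF Q])
  let ?lo = "VaR \<alpha> g Q - \<delta>" and ?hi = "VaR_upper \<alpha> g Q + \<delta>"
  let ?Psi = "\<lambda>c \<epsilon>. Psi g Q c + \<epsilon> * \<rho> {x. g x \<le> c}"
  have lim: "(?Psi c \<longlongrightarrow> Psi g Q c) (at_right 0)" for c
    by (auto intro!: tendsto_eq_intros)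
  have lo: "Psi g Q ?lo < \<alpha>" using Q.VaR_le[of ?lo] \<delta> by force
  have hi: "\<alpha> < Psi g Q ?hi" using Q.Psi_gt[of ?hi] \<delta> by simp
  have "\<forall>\<^sub>F \<epsilon> in at_right 0. perturb_prob Q \<epsilon> \<rho>" using \<rho> by (simp add: right_admissible_def)
  then show ?thesis
    using order_tendstoD(2)[OF lim lo] order_tendstoD(1)[OF lim hi] eventually_at_right_less[of 0]
  proof eventually_elim
    case (elim \<epsilon>)
    note P = finite_moment_perturb(1)[OF Q \<rho> elim(4,1)]
    interpret P: cvar_problem "perturb Q \<epsilon> \<rho>" g \<alpha> by (rule cvar_problem[OF P])
    have Psi: "Psi g (perturb Q \<epsilon> \<rho>) c = ?Psi c \<epsilon>" for c
      using perturb_probD[OF elim(1)] finite_momentD(1)[OF Q]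
      by (simp add: Psi_def borel_probsD)
    show ?case
      using P.VaR_ge[of ?lo] P.VaR_le[of ?hi] elim(2,3) by (simp add: Psi)
  qed
qed

lemma VaR_interval_nonempty:
  assumes Q: "Q \<in> finite_moment_probs" shows "VaR_interval \<alpha> g Q \<noteq> {}"
  using cvar_problem.VaR_le_VaR_upper[OF cvar_problem[OF Q]] by (simp add: VaR_interval_def)

text \<open>Danskin's argument: a minimiser of \<^term>\<open>RU \<alpha> g Q\<close> bounds the difference quotient from above;
  the minimisers of the perturbed functional, which approach the interval, bound it from below.\<close>

theorem right_derivative:
  assumes Q: "Q \<in> finite_moment_probs" and \<rho>: "right_admissible Q \<rho>"
  obtains m where "(diff_quot (CVaR \<alpha> g) Q \<rho> \<longlongrightarrow> m) (at_right 0)"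
    "is_minimum m ((\<lambda>y. signed_integral \<rho> (excess \<alpha> g y)) ` VaR_interval \<alpha> g Q)"
proof -
  interpret Q: cvar_problem Q g \<alpha> by (rule cvar_problem[OF Q])
  let ?T = "VaR_interval \<alpha> g Q"
  define D where "D y = signed_integral \<rho> (excess \<alpha> g y)" for y
  obtain K where K: "0 < K" and lip: "\<And>y z. \<bar>D y - D z\<bar> \<le> K * \<bar>y - z\<bar>"
    using signed_integral_excess_lipschitz[OF Q \<rho>] unfolding D_def by metis
  have "K-lipschitz_on ?T D"
    using K lip by (auto intro!: lipschitz_onI simp: dist_real_def)
  moreover have "compact ?T" by (simp add: VaR_interval_def)
  ultimately obtain y0 where y0: "y0 \<in> ?T" and min: "\<And>y. y \<in> ?T \<Longrightarrow> D y0 \<le> D y"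
    using continuous_attains_inf[of ?T D] VaR_interval_nonempty[OF Q] lipschitz_on_continuous_on by metis
  have ev: "\<forall>\<^sub>F \<epsilon> in at_right 0. perturb_prob Q \<epsilon> \<rho>" using \<rho> by (simp add: right_admissible_def)
  have upper: "\<forall>\<^sub>F \<epsilon> in at_right 0. diff_quot (CVaR \<alpha> g) Q \<rho> \<epsilon> \<le> D y0"
    using ev eventually_at_right_less[of 0]
  proof eventually_elim
    case (elim \<epsilon>)
    interpret P: cvar_problem "perturb Q \<epsilon> \<rho>" g \<alpha>
      by (rule cvar_problem[OF finite_moment_perturb(1)[OF Q \<rho> elim(2,1)]])
    have "CVaR \<alpha> g (perturb Q \<epsilon> \<rho>) \<le> RU \<alpha> g Q y0 + \<epsilon> * D y0"
      using P.CVaR_le_RU[of y0] by (simp add: RU_perturb[OF Q \<rho> elim(2,1)] D_def)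
    then show ?case
      using elim Q.RU_VaR_interval[OF y0] by (simp add: diff_quot_def Q.CVaR_eq_RU field_simps)
  qed
  have lower: "\<forall>\<^sub>F \<epsilon> in at_right 0. D y0 - K * \<delta> \<le> diff_quot (CVaR \<alpha> g) Q \<rho> \<epsilon>" if \<delta>: "0 < \<delta>" for \<delta>
    using ev eventually_at_right_less[of 0] eventually_VaR_near[OF Q \<rho> \<delta>]
  proof eventually_elim
    case (elim \<epsilon>)
    let ?P = "perturb Q \<epsilon> \<rho>"
    define w where "w = VaR \<alpha> g ?P"
    interpret P: cvar_problem ?P g \<alpha>
      by (rule cvar_problem[OF finite_moment_perturb(1)[OF Q \<rho> elim(2,1)]])
    \<comment> \<open>The nearest point of T(Q) to the perturbed quantile w. By the choice of y0, D
      z is at least D y0, and moving from z to w costs at most K * \<delta>.\<close>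
    define z where "z = max (VaR \<alpha> g Q) (min (VaR_upper \<alpha> g Q) w)"
    have z: "z \<in> ?T" "\<bar>w - z\<bar> \<le> \<delta>"
      using elim(3) \<delta> Q.VaR_le_VaR_upper by (auto simp: z_def w_def VaR_interval_def)
    have "K * \<bar>w - z\<bar> \<le> K * \<delta>" using K z by simp
    then have "D y0 - K * \<delta> \<le> D w"
      using min[OF z(1)] lip[of w z] by linarith
    then have "\<epsilon> * (D y0 - K * \<delta>) \<le> \<epsilon> * D w" using elim(2) by simp
    also have "\<dots> = CVaR \<alpha> g ?P - RU \<alpha> g Q w"
      by (simp add: P.CVaR_eq_RU RU_perturb[OF Q \<rho> elim(2,1)] D_def w_def)
    also have "\<dots> \<le> CVaR \<alpha> g ?P - CVaR \<alpha> g Q"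
      using Q.CVaR_le_RU[of w] by simp
    finally show ?case
      using elim(2) by (simp add: diff_quot_def field_simps)
  qed
  have "(diff_quot (CVaR \<alpha> g) Q \<rho> \<longlongrightarrow> D y0) (at_right 0)"
  proof (rule order_tendstoI)
    fix a assume "a < D y0"
    \<comment> \<open>With this \<delta> the lower bound becomes the midpoint of a and D y0, which
      is still above a.\<close>
    then have "0 < (D y0 - a) / (2 * K)" using K by simp
    from lower[OF this] show "\<forall>\<^sub>F \<epsilon> in at_right 0. a < diff_quot (CVaR \<alpha> g) Q \<rho> \<epsilon>"
    proof eventually_elim
      case (elim \<epsilon>)
      have eq: "D y0 - K * ((D y0 - a) / (2 * K)) = (D y0 + a) / 2" using K by (simp add: field_simps)
      have "(D y0 + a) / 2 \<le> diff_quot (CVaR \<alpha> g) Q \<rho> \<epsilon>" using elim by (simp only: eq)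
      with \<open>a < D y0\<close> show ?case by (simp add: field_simps)
    qed
  next
    fix a assume "D y0 < a"
    with upper show "\<forall>\<^sub>F \<epsilon> in at_right 0. diff_quot (CVaR \<alpha> g) Q \<rho> \<epsilon> < a"
      by (auto elim: eventually_mono)
  qed
  then show ?thesis
    using that[of "D y0"] y0 min by (auto simp: is_minimum_def D_def)
qed

lemma right_deriv_CVaR:
  assumes Q: "Q \<in> finite_moment_probs" and \<rho>: "right_admissible Q \<rho>"
  shows "(diff_quot (CVaR \<alpha> g) Q \<rho> \<longlongrightarrow> right_deriv (CVaR \<alpha> g) Q \<rho>) (at_right 0)"
    and "is_minimum (right_deriv (CVaR \<alpha> g) Q \<rho>)
          ((\<lambda>y. signed_integral \<rho> (excess \<alpha> g y)) ` VaR_interval \<alpha> g Q)"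
proof -
  obtain m where m: "(diff_quot (CVaR \<alpha> g) Q \<rho> \<longlongrightarrow> m) (at_right 0)"
    "is_minimum m ((\<lambda>y. signed_integral \<rho> (excess \<alpha> g y)) ` VaR_interval \<alpha> g Q)"
    by (rule right_derivative[OF Q \<rho>])
  then have "right_deriv (CVaR \<alpha> g) Q \<rho> = m"
    unfolding right_deriv_def by (intro tendsto_Lim) auto
  with m show "(diff_quot (CVaR \<alpha> g) Q \<rho> \<longlongrightarrow> right_deriv (CVaR \<alpha> g) Q \<rho>) (at_right 0)"
    "is_minimum (right_deriv (CVaR \<alpha> g) Q \<rho>)
          ((\<lambda>y. signed_integral \<rho> (excess \<alpha> g y)) ` VaR_interval \<alpha> g Q)" by auto
qed

end

section \<open>Left derivatives by reversing the direction\<close>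

lemma signed_integral_uminus: "signed_integral (\<lambda>A. - \<rho> A) f = - signed_integral \<rho> f"
  by (simp add: signed_integral_def neg_part_def)

text \<open>Both quotients evaluate J at the same perturbed measure; the outer sign comes from the
  denominator.\<close>

lemma diff_quot_uminus: "diff_quot J Q (\<lambda>A. - \<rho> A) \<epsilon> = - diff_quot J Q \<rho> (- \<epsilon>)"
  by (simp add: diff_quot_def perturb_def)

lemma is_minimum_uminus: "is_minimum (- m) ((\<lambda>y. - f y) ` S) \<longleftrightarrow> is_maximum m (f ` S)"
  by (auto simp: is_minimum_def is_maximum_def)

context lipschitz_cvar
begin

lemma left_deriv_CVaR:
  assumes Q: "Q \<in> finite_moment_probs" and \<rho>: "left_admissible Q \<rho>"
  shows "(diff_quot (CVaR \<alpha> g) Q \<rho> \<longlongrightarrow> left_deriv (CVaR \<alpha> g) Q \<rho>) (at_left 0)"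
    and "is_maximum (left_deriv (CVaR \<alpha> g) Q \<rho>)
          ((\<lambda>y. signed_integral \<rho> (excess \<alpha> g y)) ` VaR_interval \<alpha> g Q)"
    and "left_deriv (CVaR \<alpha> g) Q \<rho> = - right_deriv (CVaR \<alpha> g) Q (\<lambda>A. - \<rho> A)"
proof -
  let ?m = "right_deriv (CVaR \<alpha> g) Q (\<lambda>A. - \<rho> A)"
  note R = right_deriv_CVaR[OF Q \<rho>[unfolded left_admissible_def]]
  have "((\<lambda>\<epsilon>. - diff_quot (CVaR \<alpha> g) Q (\<lambda>A. - \<rho> A) \<epsilon>) \<longlongrightarrow> - ?m) (at_right 0)"
    by (intro tendsto_minus R)
  then have lim: "(diff_quot (CVaR \<alpha> g) Q \<rho> \<longlongrightarrow> - ?m) (at_left 0)"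
    by (simp add: filterlim_at_left_to_right[of _ _ 0] diff_quot_uminus)
  then show eq: "left_deriv (CVaR \<alpha> g) Q \<rho> = - ?m"
    unfolding left_deriv_def by (intro tendsto_Lim) auto
  show "(diff_quot (CVaR \<alpha> g) Q \<rho> \<longlongrightarrow> left_deriv (CVaR \<alpha> g) Q \<rho>) (at_left 0)"
    using lim eq by simp
  show "is_maximum (left_deriv (CVaR \<alpha> g) Q \<rho>)
          ((\<lambda>y. signed_integral \<rho> (excess \<alpha> g y)) ` VaR_interval \<alpha> g Q)"
    using R(2) by (simp add: eq signed_integral_uminus is_minimum_uminus[symmetric])
qed

lemma signed_integral_between:
  assumes Q: "Q \<in> finite_moment_probs" and \<rho>: "admissible Q \<rho>" and y: "y \<in> VaR_interval \<alpha> g Q"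
  shows "signed_integral \<rho> (excess \<alpha> g y) \<in> {right_deriv (CVaR \<alpha> g) Q \<rho> .. left_deriv (CVaR \<alpha> g) Q \<rho>}"
  using right_deriv_CVaR(2)[OF Q] left_deriv_CVaR(2)[OF Q] \<rho> y
  by (auto simp: admissible_def is_minimum_def is_maximum_def)

text \<open>The one-sided derivatives are the minimum and the maximum of one function on T(Q), so
  they agree exactly when that function is constant. Keeping the value l in the statement serves
  both the existence of the derivative and the formula for it.\<close>

lemma diff_quot_tendsto_at_0_iff:
  assumes Q: "Q \<in> finite_moment_probs" and \<rho>: "admissible Q \<rho>"
  shows "(diff_quot (CVaR \<alpha> g) Q \<rho> \<longlongrightarrow> l) (at 0) \<longleftrightarrow>
    (\<forall>y\<in>VaR_interval \<alpha> g Q. signed_integral \<rho> (excess \<alpha> g y) = l)"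
proof -
  note R = right_deriv_CVaR[OF Q, of \<rho>] and L = left_deriv_CVaR[OF Q, of \<rho>]
  have adm: "right_admissible Q \<rho>" "left_admissible Q \<rho>" using \<rho> by (auto simp: admissible_def)
  have "(diff_quot (CVaR \<alpha> g) Q \<rho> \<longlongrightarrow> l) (at 0) \<longleftrightarrow>
      right_deriv (CVaR \<alpha> g) Q \<rho> = l \<and> left_deriv (CVaR \<alpha> g) Q \<rho> = l"
    using R(1)[OF adm(1)] L(1)[OF adm(2)]
    by (auto simp: filterlim_at_split intro: tendsto_unique[rotated])
  also have "\<dots> \<longleftrightarrow> (\<forall>y\<in>VaR_interval \<alpha> g Q. signed_integral \<rho> (excess \<alpha> g y) = l)"
    using R(2)[OF adm(1)] L(2)[OF adm(2)] unfolding is_minimum_def is_maximum_def by fastforce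
  finally show ?thesis .
qed

section \<open>Lipschitz dependence on the measure in Wasserstein distance\<close>

text \<open>\<open>locally_lipschitz_W1\<close> quantifies over all Borel probability measures near
  Q. Being at finite distance from Q already forces a finite first moment, by the triangle
  inequality under a coupling of finite cost.\<close>

lemma finite_moment_wasserstein:
  assumes P: "P \<in> borel_probs" and Q: "Q \<in> finite_moment_probs" and W: "wasserstein1 P Q < \<infinity>"
  shows "P \<in> finite_moment_probs"
proof (rule finite_momentI[OF P])
  from W obtain \<pi> where \<pi>: "\<pi> \<in> couplings P Q" and fin: "(\<integral>\<^sup>+z. ennreal (dist (fst z) (snd z)) \<partial>\<pi>) < \<infinity>"
    unfolding wasserstein1_def by (auto simp: INF_less_iff)
  have [measurable_cong]: "sets \<pi> = sets (borel \<Otimes>\<^sub>M borel)" and d: "distr \<pi> borel fst = P" "distr \<pi> borel snd = Q"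
    using \<pi> by (auto simp: couplings_def)
  have "(\<integral>\<^sup>+x. ennreal (norm x) \<partial>P) = (\<integral>\<^sup>+z. ennreal (norm (fst z)) \<partial>\<pi>)"
    unfolding d(1)[symmetric] by (rule nn_integral_distr) auto
  also have "\<dots> \<le> (\<integral>\<^sup>+z. ennreal (norm (snd z)) + ennreal (dist (fst z) (snd z)) \<partial>\<pi>)"
    by (intro nn_integral_mono)
      (simp add: ennreal_plus[symmetric] dist_norm norm_triangle_sub del: ennreal_plus)
  also have "\<dots> = (\<integral>\<^sup>+z. ennreal (norm (snd z)) \<partial>\<pi>) + (\<integral>\<^sup>+z. ennreal (dist (fst z) (snd z)) \<partial>\<pi>)"
    by (rule nn_integral_add) auto
  also have "(\<integral>\<^sup>+z. ennreal (norm (snd z)) \<partial>\<pi>) = (\<integral>\<^sup>+x. ennreal (norm x) \<partial>Q)"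
    unfolding d(2)[symmetric] by (rule nn_integral_distr[symmetric]) auto
  finally show "(\<integral>\<^sup>+x. ennreal (norm x) \<partial>P) < \<infinity>"
    using finite_momentD(2)[OF Q] fin by (auto simp: top_unique less_top[symmetric])
qed

text \<open>The bound is uniform in y, so it passes to the minimum over y.\<close>

lemma RU_coupling:
  assumes P: "P \<in> finite_moment_probs" and P': "P' \<in> finite_moment_probs" and \<pi>: "\<pi> \<in> couplings P P'"
    and int: "integrable \<pi> (\<lambda>z. dist (fst z) (snd z))"
  shows "\<bar>RU \<alpha> g P y - RU \<alpha> g P' y\<bar> \<le> L / (1 - \<alpha>) * (\<integral>z. dist (fst z) (snd z) \<partial>\<pi>)"
proof -
  let ?h = "excess \<alpha> g y"
  have [measurable_cong]: "sets \<pi> = sets (borel \<Otimes>\<^sub>M borel)" and d: "distr \<pi> borel fst = P" "distr \<pi> borel snd = P'"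
    using \<pi> by (auto simp: couplings_def)
  have i: "integrable \<pi> (\<lambda>z. ?h (fst z))" "integrable \<pi> (\<lambda>z. ?h (snd z))"
    using cvar_problem.integrable_excess[OF cvar_problem[OF P], of y]
      cvar_problem.integrable_excess[OF cvar_problem[OF P'], of y]
    unfolding d[symmetric] by (auto simp: integrable_distr_eq)
  have "RU \<alpha> g P y - RU \<alpha> g P' y = (\<integral>z. ?h (fst z) - ?h (snd z) \<partial>\<pi>)"
    unfolding RU_def d[symmetric] using i by (simp add: integral_distr)
  also have "\<bar>\<dots>\<bar> \<le> (\<integral>z. \<bar>?h (fst z) - ?h (snd z)\<bar> \<partial>\<pi>)"
    by (rule integral_abs_bound)
  also have "\<dots> \<le> (\<integral>z. L / (1 - \<alpha>) * dist (fst z) (snd z) \<partial>\<pi>)"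
    using i int by (intro integral_mono excess_lipschitz) auto
  finally show ?thesis by simp
qed

lemma CVaR_wasserstein:
  assumes P: "P \<in> finite_moment_probs" and P': "P' \<in> finite_moment_probs"
  shows "ennreal \<bar>CVaR \<alpha> g P - CVaR \<alpha> g P'\<bar> \<le> ennreal ((L + 1) / (1 - \<alpha>)) * wasserstein1 P P'"
proof -
  \<comment> \<open>With L + 1 in place of L the constant stays positive even for L = 0. The proof
    divides by it, so that each coupling is treated separately and the infimum is formed before
    multiplying back.\<close>
  let ?K = "(L + 1) / (1 - \<alpha>)"
  have K: "0 < ?K" using L_nonneg alpha by simp
  interpret P: cvar_problem P g \<alpha> by (rule cvar_problem[OF P])
  interpret P': cvar_problem P' g \<alpha> by (rule cvar_problem[OF P'])
  have "ennreal (\<bar>CVaR \<alpha> g P - CVaR \<alpha> g P'\<bar> / ?K) \<le> wasserstein1 P P'"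
    unfolding wasserstein1_def
  proof (rule INF_greatest)
    fix \<pi> assume \<pi>: "\<pi> \<in> couplings P P'"
    have [measurable_cong]: "sets \<pi> = sets (borel \<Otimes>\<^sub>M borel)"
      using \<pi> by (auto simp: couplings_def)
    show "ennreal (\<bar>CVaR \<alpha> g P - CVaR \<alpha> g P'\<bar> / ?K) \<le> (\<integral>\<^sup>+z. ennreal (dist (fst z) (snd z)) \<partial>\<pi>)"
    proof (cases "(\<integral>\<^sup>+z. ennreal (dist (fst z) (snd z)) \<partial>\<pi>) < \<infinity>")
      case True
      then have int: "integrable \<pi> (\<lambda>z. dist (fst z) (snd z))"
        by (intro integrableI_nonneg) auto
      let ?I = "\<integral>z. dist (fst z) (snd z) \<partial>\<pi>"
      have "0 \<le> ?I" by simp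
      then have "L / (1 - \<alpha>) * ?I \<le> ?K * ?I"
        using alpha by (intro mult_right_mono divide_right_mono) auto
      then have RU: "\<bar>RU \<alpha> g P y - RU \<alpha> g P' y\<bar> \<le> ?K * ?I" for y
        using RU_coupling[OF P P' \<pi> int, of y] by linarith
      \<comment> \<open>Each CVaR is at most its own \<open>RU\<close> at the quantile of the other
        measure, where the two \<open>RU\<close> functions differ by at most
        \<open>?K * ?I\<close>.\<close>
      have "\<bar>CVaR \<alpha> g P - CVaR \<alpha> g P'\<bar> \<le> ?K * ?I"
        using RU[of "VaR \<alpha> g P"] RU[of "VaR \<alpha> g P'"] P.CVaR_le_RU[of "VaR \<alpha> g P'"] P'.CVaR_le_RU[of "VaR \<alpha> g P"]
        by (simp only: P.CVaR_eq_RU P'.CVaR_eq_RU)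
      then have "\<bar>CVaR \<alpha> g P - CVaR \<alpha> g P'\<bar> / ?K \<le> ?I"
        using K by (simp only: pos_divide_le_eq mult.commute)
      then show ?thesis
        using int by (subst nn_integral_eq_integral) (auto intro: ennreal_leI)
    qed (simp add: top_unique not_less)
  qed
  then have "ennreal ?K * ennreal (\<bar>CVaR \<alpha> g P - CVaR \<alpha> g P'\<bar> / ?K) \<le> ennreal ?K * wasserstein1 P P'"
    by (intro mult_left_mono) auto
  moreover have "ennreal k * ennreal (x / k) = ennreal x" if "0 < k" "0 \<le> x" for k x :: real
    using that by (simp add: ennreal_mult[symmetric])
  ultimately show ?thesis
    using K by (metis abs_ge_zero)
qed

lemma locally_lipschitz_CVaR:
  assumes Q: "Q \<in> finite_moment_probs"
  shows "locally_lipschitz_W1 (CVaR \<alpha> g) Q"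
  unfolding locally_lipschitz_W1_def
proof (rule exI[of _ 1], intro conjI, simp, rule exI[of _ "(L + 1) / (1 - \<alpha>)"], safe)
  show "0 \<le> (L + 1) / (1 - \<alpha>)" using L_nonneg alpha by simp
  fix P P' :: "'a measure" assume "P \<in> borel_probs" "P' \<in> borel_probs"
    "wasserstein1 P Q < ennreal 1" "wasserstein1 P' Q < ennreal 1"
  then show "ennreal \<bar>CVaR \<alpha> g P - CVaR \<alpha> g P'\<bar> \<le> ennreal ((L + 1) / (1 - \<alpha>)) * wasserstein1 P P'"
    by (intro CVaR_wasserstein finite_moment_wasserstein[OF _ Q])
      (auto intro: less_trans[of _ 1] simp: ennreal_one_less_top)
qed

end

section \<open>The Clarke derivative and variational subgradients\<close>

lemma perturb_uminus_cancel:
  assumes Q: "Q \<in> borel_probs" and t: "perturb_prob Q t (\<lambda>A. - \<rho> A)"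
  shows "perturb (perturb Q t (\<lambda>A. - \<rho> A)) t \<rho> = Q"
    and "perturb_prob (perturb Q t (\<lambda>A. - \<rho> A)) t \<rho>"
proof -
  have eq: "measure Q A = measure (perturb Q t (\<lambda>A. - \<rho> A)) A + t * \<rho> A" if "A \<in> sets borel" for A
    using perturb_probD(2)[OF t that] by simp
  show "perturb (perturb Q t (\<lambda>A. - \<rho> A)) t \<rho> = Q"
    by (rule perturb_eqI[OF Q eq])
  show "perturb_prob (perturb Q t (\<lambda>A. - \<rho> A)) t \<rho>"
    using Q eq by (auto simp: perturb_prob_def)
qed

text \<open>Writing -\<rho> = k(P - Q) makes Q - t\<rho> a mixture at distance at most t k C from Q,
  where C is the finite cost of the product coupling. The path therefore enters every set of the
  filter, and statements about the Limsup can be pulled back to t tending to 0.\<close>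

lemma filterlim_clarke_filter:
  assumes Q: "Q \<in> finite_moment_probs" and \<rho>: "left_admissible Q \<rho>"
  shows "filterlim (\<lambda>t. (perturb Q t (\<lambda>A. - \<rho> A), t)) (clarke_filter Q \<rho>) (at_right 0)"
proof -
  let ?\<sigma> = "\<lambda>A. - \<rho> A"
  note Q' = finite_momentD(1)[OF Q]
  from right_admissibleE[OF Q \<rho>[unfolded left_admissible_def]]
  obtain P k where P: "P \<in> finite_moment_probs" and k: "0 < k"
    and eq: "\<And>A. A \<in> sets borel \<Longrightarrow> ?\<sigma> A = k * (measure P A - measure Q A)" by blast
  define C where "C = enn2real (\<integral>\<^sup>+z. ennreal (dist (fst z) (snd z)) \<partial>(P \<Otimes>\<^sub>M Q))"
  have C: "(\<integral>\<^sup>+z. ennreal (dist (fst z) (snd z)) \<partial>(P \<Otimes>\<^sub>M Q)) = ennreal C" "0 \<le> C"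
    using product_dist_finite[OF P Q] by (auto simp: C_def)
  have "\<forall>\<^sub>F t in at_right 0. perturb Q t ?\<sigma> \<in> borel_probs \<and> wasserstein1 (perturb Q t ?\<sigma>) Q < ennreal \<delta> \<and>
      0 < t \<and> t < \<delta> \<and> perturb_prob (perturb Q t ?\<sigma>) t \<rho>" if \<delta>: "0 < \<delta>" for \<delta>
  proof -
    have "((\<lambda>t. t * k * C) \<longlongrightarrow> 0) (at_right 0)" "((\<lambda>t. t) \<longlongrightarrow> 0) (at_right (0 :: real))"
      by (auto intro!: tendsto_eq_intros)
    from order_tendstoD(2)[OF this(1) \<delta>] order_tendstoD(2)[OF this(2) \<delta>]
      order_tendstoD(2)[OF this(2), of "1 / k"] k eventually_at_right_less[of 0]
    have "\<forall>\<^sub>F t in at_right 0. t * k * C < \<delta> \<and> t < \<delta> \<and> t < 1 / k \<and> 0 < t"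
      by (auto simp: eventually_conj_iff)
    then show ?thesis
    proof eventually_elim
      case (elim t)
      note seg = perturb_prob_segment[OF finite_momentD(1)[OF P] Q' k _ _ eq, of t]
      have pp: "perturb_prob Q t ?\<sigma>" using seg elim by simp
      have "wasserstein1 (perturb Q t ?\<sigma>) Q \<le> ennreal (t * k) * ennreal C"
        using seg(2) elim C by simp
      also have "\<dots> = ennreal (t * k * C)" using elim k C by (simp add: ennreal_mult)
      also have "\<dots> < ennreal \<delta>" using elim k C by (intro ennreal_lessI) auto
      finally show ?case
        using elim perturb_probD(1)[OF pp] perturb_uminus_cancel(2)[OF Q' pp] by simp
    qed
  qed
  then show ?thesis
    unfolding clarke_filter_def filterlim_INF filterlim_principal by simp
qed

context lipschitz_cvar
begin

text \<open>Along \<open>Q' = Q - t\<rho>\<close> the Clarke quotients are left difference quotients at \<open>Q\<close>.\<close>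

lemma left_deriv_le_clarke_deriv:
  assumes Q: "Q \<in> finite_moment_probs" and \<rho>: "left_admissible Q \<rho>"
  shows "ereal (left_deriv (CVaR \<alpha> g) Q \<rho>) \<le> clarke_deriv (CVaR \<alpha> g) Q \<rho>"
proof (rule ccontr)
  let ?\<sigma> = "\<lambda>A. - \<rho> A" and ?J = "CVaR \<alpha> g"
  let ?X = "\<lambda>(Q', t). ereal (diff_quot ?J Q' \<rho> t)"
  assume "\<not> ereal (left_deriv ?J Q \<rho>) \<le> clarke_deriv ?J Q \<rho>"
  \<comment> \<open>A level strictly between the two would be exceeded along the path Q - t\<rho>,
    while all quotients eventually lie below it.\<close>
  then obtain z where z: "z < ereal (left_deriv ?J Q \<rho>)" and "clarke_deriv ?J Q \<rho> < z"
    using dense[of "clarke_deriv ?J Q \<rho>" "ereal (left_deriv ?J Q \<rho>)"] by (auto simp: not_le)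
  then have less: "\<forall>\<^sub>F x in clarke_filter Q \<rho>. ?X x < z"
    unfolding clarke_deriv_def by (intro Limsup_lessD)
  have R: "right_admissible Q ?\<sigma>" using \<rho> by (simp add: left_admissible_def)
  have "((\<lambda>t. - diff_quot ?J Q ?\<sigma> t) \<longlongrightarrow> left_deriv ?J Q \<rho>) (at_right 0)"
    unfolding left_deriv_CVaR(3)[OF Q \<rho>] by (intro tendsto_minus right_deriv_CVaR[OF Q R])
  then have "((\<lambda>t. ereal (- diff_quot ?J Q ?\<sigma> t)) \<longlongrightarrow> ereal (left_deriv ?J Q \<rho>)) (at_right 0)"
    by simp
  from order_tendstoD(1)[OF this z]
  have gt: "\<forall>\<^sub>F t in at_right 0. z < ereal (- diff_quot ?J Q ?\<sigma> t)" .
  have "\<forall>\<^sub>F t in at_right 0. perturb_prob Q t ?\<sigma>"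
    using R by (simp add: right_admissible_def)
  with gt have ev: "\<forall>\<^sub>F t in at_right 0. z < ?X (perturb Q t ?\<sigma>, t)"
  proof eventually_elim
    case (elim t)
    then have "diff_quot ?J (perturb Q t ?\<sigma>) \<rho> t = - diff_quot ?J Q ?\<sigma> t"
      using perturb_uminus_cancel(1)[OF finite_momentD(1)[OF Q]]
      by (simp add: diff_quot_def minus_divide_left)
    with elim show ?case by simp
  qed
  have "\<forall>\<^sub>F t in at_right 0. ?X (perturb Q t ?\<sigma>, t) < z"
    by (rule eventually_compose_filterlim[OF less filterlim_clarke_filter[OF Q \<rho>]])
  with ev have "\<forall>\<^sub>F t in at_right (0 :: real). False"
    by eventually_elim simp
  then show False by simp
qed

lemma variational_subgradient_excess:
  assumes Q: "Q \<in> finite_moment_probs" and y: "y \<in> VaR_interval \<alpha> g Q"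
  shows "variational_subgradient (CVaR \<alpha> g) Q (excess \<alpha> g y)"
  unfolding variational_subgradient_def
proof (intro conjI allI impI locally_lipschitz_CVaR Q)
  fix \<rho> assume \<rho>: "admissible Q \<rho>"
  then have adm: "right_admissible Q \<rho>" "left_admissible Q \<rho>" by (auto simp: admissible_def)
  show "signed_integrable \<rho> (excess \<alpha> g y)"
    using right_admissibleE[OF Q adm(1)] signed_integrable_excess[OF _ Q] by (metis less_imp_le)
  have "ereal (signed_integral \<rho> (excess \<alpha> g y)) \<le> ereal (left_deriv (CVaR \<alpha> g) Q \<rho>)"
    using signed_integral_between[OF Q \<rho> y] by simp
  also have "\<dots> \<le> clarke_deriv (CVaR \<alpha> g) Q \<rho>"
    by (rule left_deriv_le_clarke_deriv[OF Q adm(2)])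
  finally show "ereal (signed_integral \<rho> (excess \<alpha> g y)) \<le> clarke_deriv (CVaR \<alpha> g) Q \<rho>" .
qed

end

section \<open>Gateaux differentiability and uniqueness of the quantile\<close>

lemma finite_moment_uniform_measure:
  assumes Q: "Q \<in> finite_moment_probs" and A: "A \<in> sets borel" "0 < measure Q A"
  shows "uniform_measure Q A \<in> finite_moment_probs"
proof (rule finite_momentI)
  note Q' = finite_momentD[OF Q]
  interpret Q: prob_space Q by (rule borel_probsD[OF Q'(1)])
  have ne: "emeasure Q A \<noteq> 0" "emeasure Q A \<noteq> \<infinity>" using A by (auto simp: Q.emeasure_eq_measure)
  show "uniform_measure Q A \<in> borel_probs"
    using prob_space_uniform_measure[OF ne] borel_probsD(2)[OF Q'(1)] by (simp add: borel_probs_def)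
  have "(\<integral>\<^sup>+x. ennreal (norm x) * indicator A x \<partial>Q) \<le> (\<integral>\<^sup>+x. ennreal (norm x) \<partial>Q)"
    by (intro nn_integral_mono) (auto simp: indicator_def)
  then show "(\<integral>\<^sup>+x. ennreal (norm x) \<partial>uniform_measure Q A) < \<infinity>"
    using A Q' ne borel_probsD(2)[OF Q'(1)]
    by (subst nn_integral_uniform_measure) (auto simp: measurable_borel_probs ennreal_divide_eq_top_iff
        less_top[symmetric] top_unique)
qed

context lipschitz_cvar
begin

text \<open>The direction transports mass between the conditional laws of \<^term>\<open>Q\<close> below and above the
  quantile; below it the excess vanishes throughout the interval, above it it decreases strictly in \<open>y\<close>.\<close>

lemma exists_nonconstant_direction:
  assumes Q: "Q \<in> finite_moment_probs" and less: "VaR \<alpha> g Q < VaR_upper \<alpha> g Q"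
  obtains \<rho> where "admissible Q \<rho>"
    "signed_integral \<rho> (excess \<alpha> g (VaR \<alpha> g Q)) \<noteq> signed_integral \<rho> (excess \<alpha> g (VaR_upper \<alpha> g Q))"
proof -
  note Q' = finite_momentD(1)[OF Q]
  interpret Q: cvar_problem Q g \<alpha> by (rule cvar_problem[OF Q])
  define v u where "v = VaR \<alpha> g Q" and "u = VaR_upper \<alpha> g Q"
  define A where "A = {x. g x \<le> v}"
  define a where "a = measure Q A"
  have A [measurable]: "A \<in> sets borel" "- A \<in> sets borel" unfolding A_def by measurable
  have "a = Psi g Q v" by (simp add: a_def A_def Psi_def borel_probsD[OF Q'])
  \<comment> \<open>A gap between the two quantiles forces Psi v = \<alpha>, strictly between 0 and
    1, so both A and its complement have positive mass and can be conditioned on.\<close>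
  moreover have "Psi g Q v \<le> \<alpha>" using Q.VaR_upper_le[of v] less by (force simp: v_def)
  ultimately have a: "0 < a" "a < 1"
    using Q.Psi_VaR_ge alpha by (auto simp: v_def)
  have compl: "measure Q (- A) = 1 - a"
    using Q.prob_compl[of A] by (simp add: a_def borel_probsD[OF Q'] Compl_eq_Diff_UNIV)
  define P0 P1 where "P0 = uniform_measure Q A" and "P1 = uniform_measure Q (- A)"
  have P: "P0 \<in> finite_moment_probs" "P1 \<in> finite_moment_probs"
    unfolding P0_def P1_def using a compl by (auto intro!: finite_moment_uniform_measure[OF Q] simp: a_def[symmetric])
  have m: "measure P0 B = measure Q (A \<inter> B) / a" "measure P1 B = measure Q (- A \<inter> B) / (1 - a)"
    if B: "B \<in> sets borel" for B
    using a compl B unfolding P0_def P1_def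
    by (auto simp: measure_uniform_measure Q.emeasure_eq_measure borel_probsD[OF Q'] a_def[symmetric])
  have split: "measure Q B = measure Q (A \<inter> B) + measure Q (- A \<inter> B)" if B: "B \<in> sets borel" for B
    using B by (subst Q.finite_measure_Union[symmetric])
      (auto simp: borel_probsD[OF Q'] intro!: arg_cong[where f="measure Q"])
  \<comment> \<open>Since Q = a P0 + (1 - a) P1, one has P0 - Q = (1 - a)\<rho> and P1 - Q =
    -a\<rho>. Thus \<rho> and -\<rho> are both multiples of a difference from Q, with the factors 1
    / (1 - a) and 1 / a below, and \<rho> is admissible on both sides.\<close>
  define \<rho> where "\<rho> B = measure P0 B - measure P1 B" for B
  have r0: "\<rho> B = 1 / (1 - a) * (measure P0 B - measure Q B)" if "B \<in> sets borel" for B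
    using a unfolding \<rho>_def m[OF that] split[OF that] by (simp add: divide_simps) (simp add: algebra_simps)
  have r1: "- \<rho> B = 1 / a * (measure P1 B - measure Q B)" if "B \<in> sets borel" for B
    using a unfolding \<rho>_def m[OF that] split[OF that] by (simp add: divide_simps) (simp add: algebra_simps)
  have "right_admissible Q \<rho>"
    using a by (intro right_admissible_difference[OF P(1) Q _ r0]) auto
  moreover have "left_admissible Q \<rho>"
    unfolding left_admissible_def using a by (intro right_admissible_difference[OF P(2) Q _ r1]) auto
  ultimately have adm: "admissible Q \<rho>" by (simp add: admissible_def)
  have D: "signed_integral \<rho> (excess \<alpha> g y) = (\<integral>x. excess \<alpha> g y x \<partial>P0) - (\<integral>x. excess \<alpha> g y x \<partial>P1)" for y
    using signed_integral_excess[OF P, of 1 \<rho> y] by (simp add: \<rho>_def)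
  have zero: "(\<integral>x. excess \<alpha> g y x \<partial>P0) = 0" if "v \<le> y" for y
  proof -
    have "AE x in P0. excess \<alpha> g y x = 0"
      unfolding P0_def using that
      by (intro AE_uniform_measureI) (auto simp: A_def excess_def borel_probsD[OF Q'])
    then show ?thesis by (rule integral_eq_zero_AE)
  qed
  interpret P1: cvar_problem P1 g \<alpha> by (rule cvar_problem[OF P(2)])
  have "AE x in P1. excess \<alpha> g u x < excess \<alpha> g v x"
    unfolding P1_def using less alpha
    by (intro AE_uniform_measureI)
      (auto simp: A_def excess_def borel_probsD[OF Q'] u_def v_def divide_strict_right_mono)
  then have "(\<integral>x. excess \<alpha> g u x \<partial>P1) < (\<integral>x. excess \<alpha> g v x \<partial>P1)"
    by (intro P1.integral_less_AE_space P1.integrable_excess) (auto simp: P1.emeasure_space_1)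
  then have "signed_integral \<rho> (excess \<alpha> g v) \<noteq> signed_integral \<rho> (excess \<alpha> g u)"
    using zero[of v] zero[of u] less by (simp add: D u_def v_def)
  with adm show ?thesis using that by (simp add: u_def v_def)
qed

lemma gateaux_iff_constant:
  assumes Q: "Q \<in> finite_moment_probs" and \<rho>: "admissible Q \<rho>"
  shows "gateaux_deriv_exists (CVaR \<alpha> g) Q \<rho> \<longleftrightarrow>
    (\<lambda>y. signed_integral \<rho> (excess \<alpha> g y)) constant_on VaR_interval \<alpha> g Q"
  by (auto simp: gateaux_deriv_exists_def diff_quot_tendsto_at_0_iff[OF Q \<rho>] constant_on_def)

lemma is_singleton_VaR_interval_iff:
  assumes Q: "Q \<in> finite_moment_probs"
  shows "is_singleton (VaR_interval \<alpha> g Q) \<longleftrightarrow> VaR \<alpha> g Q = VaR_upper \<alpha> g Q"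
  using cvar_problem.VaR_le_VaR_upper[OF cvar_problem[OF Q]]
  by (auto simp: is_singleton_def VaR_interval_def atLeastAtMost_singleton_iff)

lemma gateaux_all_iff_is_singleton:
  assumes Q: "Q \<in> finite_moment_probs"
  shows "(\<forall>\<rho>. admissible Q \<rho> \<longrightarrow> gateaux_deriv_exists (CVaR \<alpha> g) Q \<rho>) \<longleftrightarrow> is_singleton (VaR_interval \<alpha> g Q)"
proof
  assume "is_singleton (VaR_interval \<alpha> g Q)"
  then show "\<forall>\<rho>. admissible Q \<rho> \<longrightarrow> gateaux_deriv_exists (CVaR \<alpha> g) Q \<rho>"
    by (auto simp: gateaux_iff_constant[OF Q] is_singleton_def constant_on_def)
next
  assume all: "\<forall>\<rho>. admissible Q \<rho> \<longrightarrow> gateaux_deriv_exists (CVaR \<alpha> g) Q \<rho>"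
  have le: "VaR \<alpha> g Q \<le> VaR_upper \<alpha> g Q"
    by (rule cvar_problem.VaR_le_VaR_upper[OF cvar_problem[OF Q]])
  have "\<not> VaR \<alpha> g Q < VaR_upper \<alpha> g Q"
  proof
    assume "VaR \<alpha> g Q < VaR_upper \<alpha> g Q"
    then obtain \<rho> where \<rho>: "admissible Q \<rho>"
      "signed_integral \<rho> (excess \<alpha> g (VaR \<alpha> g Q)) \<noteq> signed_integral \<rho> (excess \<alpha> g (VaR_upper \<alpha> g Q))"
      by (rule exists_nonconstant_direction[OF Q])
    moreover have "VaR \<alpha> g Q \<in> VaR_interval \<alpha> g Q" "VaR_upper \<alpha> g Q \<in> VaR_interval \<alpha> g Q"
      using le by (auto simp: VaR_interval_def)
    ultimately show False
      using all by (auto simp: gateaux_iff_constant[OF Q] constant_on_def)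
  qed
  with le show "is_singleton (VaR_interval \<alpha> g Q)" by (simp add: is_singleton_VaR_interval_iff[OF Q])
qed

lemma first_variation_CVaR:
  assumes Q: "Q \<in> finite_moment_probs" and eq: "VaR \<alpha> g Q = VaR_upper \<alpha> g Q"
  shows "has_first_variation (CVaR \<alpha> g) Q (excess \<alpha> g (VaR \<alpha> g Q))"
  unfolding has_first_variation_def
proof (intro allI impI conjI)
  have T: "VaR_interval \<alpha> g Q = {VaR \<alpha> g Q}" using eq by (simp add: VaR_interval_def)
  fix \<rho> assume \<rho>: "admissible Q \<rho>"
  then show "signed_integrable \<rho> (excess \<alpha> g (VaR \<alpha> g Q))"
    using variational_subgradient_excess[OF Q] T by (simp add: variational_subgradient_def)
  show "(diff_quot (CVaR \<alpha> g) Q \<rho> \<longlongrightarrow> signed_integral \<rho> (excess \<alpha> g (VaR \<alpha> g Q))) (at 0)"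
    by (simp add: diff_quot_tendsto_at_0_iff[OF Q \<rho>] T)
qed

end

theorem theorem3p5:
  fixes g :: "real ^ 'd \<Rightarrow> real" and \<alpha> :: real and Q :: "(real ^ 'd) measure"
  assumes g_nonneg: "\<And>x. 0 \<le> g x"
    and g_lipschitz: "\<exists>L. L-lipschitz_on UNIV g"
    and alpha: "0 < \<alpha>" "\<alpha> < 1"
    and Q_prob: "Q \<in> borel_probs"
    and Q_moment: "integrable Q (\<lambda>x. norm x)"
  shows
    "(\<forall>\<rho>. right_admissible Q \<rho> \<longrightarrow>
        (diff_quot (CVaR \<alpha> g) Q \<rho> \<longlongrightarrow> right_deriv (CVaR \<alpha> g) Q \<rho>) (at_right 0) \<and>
        is_minimum (right_deriv (CVaR \<alpha> g) Q \<rho>)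
          ((\<lambda>y. signed_integral \<rho> (excess \<alpha> g y)) ` VaR_interval \<alpha> g Q))
   \<and> (\<forall>\<rho>. left_admissible Q \<rho> \<longrightarrow>
        (diff_quot (CVaR \<alpha> g) Q \<rho> \<longlongrightarrow> left_deriv (CVaR \<alpha> g) Q \<rho>) (at_left 0) \<and>
        is_maximum (left_deriv (CVaR \<alpha> g) Q \<rho>)
          ((\<lambda>y. signed_integral \<rho> (excess \<alpha> g y)) ` VaR_interval \<alpha> g Q))
   \<and> (\<forall>y\<in>VaR_interval \<alpha> g Q.
        (\<forall>\<rho>. admissible Q \<rho> \<longrightarrow>
          signed_integral \<rho> (excess \<alpha> g y)
            \<in> {right_deriv (CVaR \<alpha> g) Q \<rho> .. left_deriv (CVaR \<alpha> g) Q \<rho>}) \<and>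
        variational_subgradient (CVaR \<alpha> g) Q (excess \<alpha> g y))
   \<and> (\<forall>\<rho>. admissible Q \<rho> \<longrightarrow>
        (gateaux_deriv_exists (CVaR \<alpha> g) Q \<rho> \<longleftrightarrow>
          (\<lambda>y. signed_integral \<rho> (excess \<alpha> g y)) constant_on VaR_interval \<alpha> g Q))
   \<and> ((\<forall>\<rho>. admissible Q \<rho> \<longrightarrow> gateaux_deriv_exists (CVaR \<alpha> g) Q \<rho>) \<longleftrightarrow>
        is_singleton (VaR_interval \<alpha> g Q))
   \<and> (is_singleton (VaR_interval \<alpha> g Q) \<longleftrightarrow> VaR \<alpha> g Q = VaR_upper \<alpha> g Q)
   \<and> (VaR \<alpha> g Q = VaR_upper \<alpha> g Q \<longrightarrow>
        has_first_variation (CVaR \<alpha> g) Q (excess \<alpha> g (VaR \<alpha> g Q)))"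
proof -
  obtain L where "L-lipschitz_on UNIV g" using g_lipschitz by blast
  then interpret lipschitz_cvar g \<alpha> L
    using alpha by unfold_locales
  have Q: "Q \<in> finite_moment_probs"
    using Q_prob Q_moment by (simp add: finite_moment_probs_def)
  show ?thesis
    by (intro conjI allI ballI impI right_deriv_CVaR[OF Q] left_deriv_CVaR(1,2)[OF Q]
        signed_integral_between[OF Q] variational_subgradient_excess[OF Q] gateaux_iff_constant[OF Q]
        gateaux_all_iff_is_singleton[OF Q] is_singleton_VaR_interval_iff[OF Q] first_variation_CVaR[OF Q])
qed

end
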